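(* Let $p\in(0,1]$ and let $\mu$ be a probability measure on $\mathbb{N}=\{0,1,2,\dots\}$ with full support, with associated birth-death Dirichlet form $\mathcal{E}(f,g)=\sum_{k\ge0}(f(k+1)-f(k))(g(k+1)-g(k))\mu(\{k\})$. (1) If $\mu$ satisfies the Poincaré inequality with some finite constant $C_P>0$ and $$\hat C:=\sup_{n\ge1}\Big\{\Big[H_p\Big(\frac{\mu[n-1,\infty)}{\mu[n,\infty)}\Big)\Big]^{-1}\cdot\log\Big(\frac{2}{\mu[n,\infty)}\Big)\Big\}<\infty,$$ then $\mu$ satisfies $p$-LS$(C)$ with some finite $C>0$. (2) Contrarily, if there exists an increasing sequence $\tau_0<\tau_1<\dots$ of elements of $\mathbb{N}$ such that $$\lim_{n\to\infty}\Big\{\Big[H_p\Big(\frac{\mu[\tau_{n-1},\infty)}{\mu[\tau_n,\infty)}\Big)\Big]^{-1}\cdot\frac{\mu[\tau_{n-1},\infty)}{\mu[\tau_n-1,\infty)}\cdot\log\Big(\frac{2}{\mu[\tau_n,\infty)}\Big)\Big\}=\infty,$$ then $\mu$ does not satisfy $p$-LS$(C)$ with any finite $C>0$.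
   Context: Notation: $\mu_k=\mu(\{k\})$, $\mu[k,\infty)=\mu([k,\infty))$, $Df(k)=f(k+1)-f(k)$, and $\mathcal{E}(f,g)=\sum_{k\ge0}Df(k)Dg(k)\mu_k$ with domain $\mathcal{H}=\{h\in L_2(\mathbb{N},\mu):\sum_{k\ge0}(Dh(k))^2\mu_k<\infty\}$. $\mathcal{H}_+$ is the set of $f\in\mathcal{H}$ with values in $(0,\infty)$, and $\mathrm{Ent}_\mu(f)=\int f\log f\,d\mu-\int f\,d\mu\,\log\int f\,d\mu$. For $x>0$, with $p'=p/(p-1)$ (so $1/p'=1-1/p$), $$H_p(x)=\begin{cases}pp'(x^{1/p}-1)(x^{1/p'}-1)&\text{if }p\in(0,1),\\(x-1)\log x&\text{if }p=1.\end{cases}$$ The Poincaré inequality with constant $C_P$: $\mathrm{Var}_\mu(f)\le\frac{C_P}{2}\mathcal{E}(f,f)$ for all $f\in\mathcal{H}$. $p$-LS$(C)$ (the $p$-log-Sobolev inequality with constant $C>0$): for $p\in(0,1)$, $\mathrm{Ent}_\mu(f^p)\le\frac{Cp^2}{4(p-1)}\mathcal{E}(f^{p-1},f)$ for all $f\in\mathcal{H}_+$ with $f^{p-1}\in\mathcal{H}_+$; for $p=1$, $\mathrm{Ent}_\mu(f)\le\frac C4\mathcal{E}(f,\log f)$ for all $f\in\mathcal{H}_+$ with $\log f\in\mathcal{H}$. Equivalently (after replacing $f$ by $f^{1/p}$), $\mathrm{Ent}_\mu(f)\le\frac C4\sum_{k\ge0}f(k)H_p\big(\frac{f(k+1)}{f(k)}\big)\mu_k$.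 *)

theory Defs
  imports "HOL-Probability.Probability"
begin

text \<open>
  A probability measure \<open>\<mu>\<close> on the natural numbers is a \<^typ>\<open>nat pmf\<close>, so \<open>\<mu>({k})\<close> is
  \<open>pmf \<mu> k\<close>, and \<open>\<mu>\<close> has full support iff \<open>set_pmf \<mu> = UNIV\<close>.
\<close>

definition tail :: "nat pmf \<Rightarrow> nat \<Rightarrow> real" where
  "tail \<mu> k = measure_pmf.prob \<mu> {k..}"

definition fwd_diff :: "(nat \<Rightarrow> real) \<Rightarrow> nat \<Rightarrow> real" where
  "fwd_diff f k = f (k + 1) - f k"

text \<open>The series converges absolutely for \<open>f\<close> and \<open>g\<close> in the domain defined next
  (Cauchy--Schwarz); this is the only case in which it is used below.\<close>

definition dirichlet_form :: "nat pmf \<Rightarrow> (nat \<Rightarrow> real) \<Rightarrow> (nat \<Rightarrow> real) \<Rightarrow> real" where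
  "dirichlet_form \<mu> f g = (\<Sum>k. fwd_diff f k * fwd_diff g k * pmf \<mu> k)"

definition dirichlet_dom :: "nat pmf \<Rightarrow> (nat \<Rightarrow> real) set" where
  "dirichlet_dom \<mu> =
     {h. integrable (measure_pmf \<mu>) (\<lambda>k. (h k)\<^sup>2) \<and>
         summable (\<lambda>k. (fwd_diff h k)\<^sup>2 * pmf \<mu> k)}"

definition dirichlet_dom_pos :: "nat pmf \<Rightarrow> (nat \<Rightarrow> real) set" where
  "dirichlet_dom_pos \<mu> = {f \<in> dirichlet_dom \<mu>. \<forall>k. 0 < f k}"

definition Ent :: "nat pmf \<Rightarrow> (nat \<Rightarrow> real) \<Rightarrow> real" where
  "Ent \<mu> f =
     measure_pmf.expectation \<mu> (\<lambda>k. f k * ln (f k)) -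
     measure_pmf.expectation \<mu> f * ln (measure_pmf.expectation \<mu> f)"

definition poincare :: "nat pmf \<Rightarrow> real \<Rightarrow> bool" where
  "poincare \<mu> C \<longleftrightarrow>
     (\<forall>f \<in> dirichlet_dom \<mu>. measure_pmf.variance \<mu> f \<le> C / 2 * dirichlet_form \<mu> f f)"

text \<open>The exponent conjugate to \<open>p\<close>; it is negative for \<open>p \<in> (0, 1)\<close>.\<close>

definition conj_exp :: "real \<Rightarrow> real" where
  "conj_exp p = p / (p - 1)"

text \<open>The next two notions are meant for \<open>p \<in> (0, 1]\<close> only (and \<open>x > 0\<close>).\<close>

definition H :: "real \<Rightarrow> real \<Rightarrow> real" where
  "H p x =
     (if p = 1 then (x - 1) * ln x
      else p * conj_exp p * (x powr (1 / p) - 1) * (x powr (1 / conj_exp p) - 1))"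

definition log_sobolev :: "real \<Rightarrow> nat pmf \<Rightarrow> real \<Rightarrow> bool" where
  "log_sobolev p \<mu> C \<longleftrightarrow>
     (if p = 1 then
        \<forall>f \<in> dirichlet_dom_pos \<mu>. (\<lambda>k. ln (f k)) \<in> dirichlet_dom \<mu> \<longrightarrow>
          Ent \<mu> f \<le> C / 4 * dirichlet_form \<mu> f (\<lambda>k. ln (f k))
      else
        \<forall>f \<in> dirichlet_dom_pos \<mu>. (\<lambda>k. f k powr (p - 1)) \<in> dirichlet_dom_pos \<mu> \<longrightarrow>
          Ent \<mu> (\<lambda>k. f k powr p) \<le>
            C * p\<^sup>2 / (4 * (p - 1)) * dirichlet_form \<mu> (\<lambda>k. f k powr (p - 1)) f)"

end

theory Submission
  imports Defs "HOL-Real_Asymp.Real_Asymp"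
begin

text \<open>
  Part 1. Poincare applied to the indicator of a half-line gives \<open>\<mu>[k+1,\<infinity>) \<le> K \<mu>\<^sub>k\<close>, so the tail
  ratios are at least some \<open>r\<^sup>2 > 1\<close>. For \<open>g > 0\<close> of mean 1 put \<open>\<phi>(x) = x ln x - x + 1\<close>; then
  \<open>Ent(g) = \<integral> \<phi>(g) d\<mu>\<close>. The quantity \<open>w\<^sub>k = \<phi>(g(k)) \<mu>[k,\<infinity>)\<close>, which dominates \<open>\<phi>(g(k)) \<mu>\<^sub>k\<close>, satisfies
  \<open>w\<^sub>k\<^sub>+\<^sub>1 \<le> w\<^sub>k / r + K' \<cdot> (energy of the edge + contributions to \<integral> (\<surd>g - 1)\<^sup>2 d\<mu>)\<close>. Summing this contraction
  bounds the entropy, since \<open>\<integral> (\<surd>g - 1)\<^sup>2 d\<mu> \<le> 2 Var(\<surd>g)\<close> is bounded by the energy by Poincare.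

  Part 2. Test with the staircase equal to \<open>1 / T\<^sub>j\<close> on \<open>[\<tau>\<^sub>j, \<tau>\<^sub>j\<^sub>+\<^sub>1)\<close>, frozen after \<open>N\<close> steps, where
  \<open>T\<^sub>j = \<mu>[\<tau>\<^sub>j,\<infinity>)\<close>. With \<open>w\<^sub>j = 1 - T\<^sub>j\<^sub>+\<^sub>1 / T\<^sub>j\<close>, \<open>L\<^sub>j = ln (1 / T\<^sub>j\<^sub>+\<^sub>1)\<close>, its mean is
  \<open>M = 1 / T\<^sub>0 + \<Sum> w\<^sub>j\<close> and its entropy is at least \<open>\<Sum> w\<^sub>j L\<^sub>j - M ln M\<close>, where
  \<open>\<Sum> w\<^sub>j L\<^sub>j \<ge> (\<Sum> w\<^sub>j)\<^sup>2 / 2\<close> tends to infinity and dominates \<open>M ln M\<close>. The hypothesis makes the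
  energy of the \<open>j\<close>-th jump \<open>o(w\<^sub>j L\<^sub>j)\<close>: directly when \<open>T\<^sub>j \<ge> 2 T\<^sub>j\<^sub>+\<^sub>1\<close>, and because
  \<open>H\<^sub>p(x) = O(1 - 1/x)\<close> on \<open>[1, 2]\<close> otherwise.
\<close>

section \<open>Tails and the Dirichlet form\<close>

lemma pmf_nat_expectation_sums:
  fixes f :: "nat \<Rightarrow> real"
  assumes "integrable (measure_pmf \<mu>) f"
  shows "(\<lambda>k. f k * pmf \<mu> k) sums measure_pmf.expectation \<mu> f"
proof -
  have "integrable (count_space UNIV) (\<lambda>k. pmf \<mu> k * f k)"
    using assms
    by (subst (asm) measure_pmf_eq_density, subst (asm) integrable_density) simp_all
  then have "(\<lambda>k. pmf \<mu> k * f k) sums (\<integral>k. pmf \<mu> k * f k \<partial>count_space UNIV)"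
    by (rule sums_integral_count_space_nat)
  moreover have "(\<integral>k. pmf \<mu> k * f k \<partial>count_space UNIV) = measure_pmf.expectation \<mu> f"
    by (subst measure_pmf_eq_density, subst integral_density) simp_all
  ultimately show ?thesis by (simp add: mult.commute[of "pmf _ _"])
qed

lemma pmf_nat_sums_1: "pmf \<mu> sums (1::real)" for \<mu> :: "nat pmf"
  using pmf_nat_expectation_sums[of \<mu> "\<lambda>_. 1"] by simp

lemma tail_0: "tail \<mu> 0 = 1"
  by (simp add: tail_def)

lemma tail_Suc: "tail \<mu> k = pmf \<mu> k + tail \<mu> (Suc k)"
proof -
  have "{k..} = {k} \<union> {Suc k..}" by auto
  then have "tail \<mu> k = measure_pmf.prob \<mu> ({k} \<union> {Suc k..})" by (simp only: tail_def)
  also have "\<dots> = measure_pmf.prob \<mu> {k} + measure_pmf.prob \<mu> {Suc k..}"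
    by (rule measure_pmf.finite_measure_Union) auto
  finally show ?thesis by (simp only: tail_def measure_pmf_single)
qed

lemma tail_antimono: "m \<le> n \<Longrightarrow> tail \<mu> n \<le> tail \<mu> m"
  unfolding tail_def by (intro measure_pmf.finite_measure_mono) auto

lemma tail_le_1: "tail \<mu> n \<le> 1"
  unfolding tail_def by simp

lemma pmf_le_tail: "pmf \<mu> n \<le> tail \<mu> n"
  by (simp add: tail_Suc[of \<mu> n]) (simp add: tail_def)

lemma tail_eq: "tail \<mu> n = 1 - (\<Sum>k<n. pmf \<mu> k)"
proof (induction n)
  case (Suc n)
  then show ?case using tail_Suc[of \<mu> n] by simp
qed (simp add: tail_0)

lemma tail_tendsto_0: "tail \<mu> \<longlonglongrightarrow> 0"
proof -
  have "(\<lambda>n. \<Sum>k<n. pmf \<mu> k) \<longlonglongrightarrow> 1"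
    using pmf_nat_sums_1[of \<mu>] by (simp add: sums_def)
  from tendsto_diff[OF tendsto_const[of 1] this] show ?thesis
    by (simp add: tail_eq[abs_def])
qed

text \<open>The total mass is finite, so a bound on \<open>f\<close> and its differences suffices.
  This admits every test function used below: half-line indicators, and powers and logarithms of
  staircases.\<close>

lemma bounded_in_dirichlet_dom:
  assumes "\<And>k. \<bar>f k\<bar> \<le> B"
  shows "f \<in> dirichlet_dom \<mu>"
proof -
  have B: "0 \<le> B" using assms[of 0] by linarith
  have "integrable (measure_pmf \<mu>) (\<lambda>k. (f k)\<^sup>2)"
    by (rule measure_pmf.integrable_const_bound[of _ "B\<^sup>2"])
       (use assms B in \<open>auto intro!: AE_I2 simp: abs_le_square_iff[symmetric]\<close>)
  moreover have "summable (\<lambda>k. (fwd_diff f k)\<^sup>2 * pmf \<mu> k)"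
  proof (rule summable_comparison_test')
    show "summable (\<lambda>k. (2 * B)\<^sup>2 * pmf \<mu> k)"
      by (intro summable_mult sums_summable[OF pmf_nat_sums_1])
    fix k :: nat
    have "\<bar>fwd_diff f k\<bar> \<le> \<bar>2 * B\<bar>"
      using assms[of k] assms[of "k + 1"] by (simp add: fwd_diff_def)
    then show "norm ((fwd_diff f k)\<^sup>2 * pmf \<mu> k) \<le> (2 * B)\<^sup>2 * pmf \<mu> k"
      by (simp add: abs_le_square_iff mult_right_mono)
  qed
  ultimately show ?thesis by (simp add: dirichlet_dom_def)
qed

lemma dirichlet_form_summable:
  assumes "f \<in> dirichlet_dom \<mu>" "g \<in> dirichlet_dom \<mu>"
  shows "summable (\<lambda>k. fwd_diff f k * fwd_diff g k * pmf \<mu> k)"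
proof (rule summable_comparison_test')
  show "summable (\<lambda>k. (fwd_diff f k)\<^sup>2 * pmf \<mu> k + (fwd_diff g k)\<^sup>2 * pmf \<mu> k)"
    using assms by (intro summable_add) (auto simp: dirichlet_dom_def)
  fix k :: nat
  have "\<bar>a * b\<bar> \<le> a\<^sup>2 + b\<^sup>2" for a b :: real
  proof -
    have "2 * (\<bar>a\<bar> * \<bar>b\<bar>) \<le> a\<^sup>2 + b\<^sup>2"
      using sum_squares_bound[of "\<bar>a\<bar>" "\<bar>b\<bar>"] by (simp add: mult.assoc)
    moreover have "0 \<le> \<bar>a\<bar> * \<bar>b\<bar>" by simp
    ultimately show ?thesis unfolding abs_mult by linarith
  qed
  from mult_right_mono[OF this pmf_nonneg, of "fwd_diff f k" "fwd_diff g k" \<mu> k]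
  show "norm (fwd_diff f k * fwd_diff g k * pmf \<mu> k)
      \<le> (fwd_diff f k)\<^sup>2 * pmf \<mu> k + (fwd_diff g k)\<^sup>2 * pmf \<mu> k"
    by (simp add: abs_mult distrib_right)
qed

section \<open>The functions \<open>H\<^sub>p\<close>\<close>

lemma H_1: "H p 1 = 0"
  by (simp add: H_def)

text \<open>The conjugate exponent is negative; moving the sign of \<open>p * conj_exp p\<close>
  into the last factor leaves factors that are all positive for \<open>x > 1\<close>.\<close>

lemma H_eq:
  assumes "0 < p" "p < 1"
  shows "H p x = p\<^sup>2 / (1 - p) * ((x powr (1 / p) - 1) * (1 - x powr (- (1 / p - 1))))"
proof -
  have e: "1 / conj_exp p = - (1 / p - 1)"
    using assms by (simp add: conj_exp_def field_simps)
  have c: "p * conj_exp p = - (p\<^sup>2 / (1 - p))"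
    using assms by (simp add: conj_exp_def power2_eq_square field_simps)
  have sgn: "- u * v * (w - 1) = u * (v * (1 - w))" for u v w :: real
    by (simp add: algebra_simps)
  have "p \<noteq> 1" using assms by simp
  show ?thesis unfolding H_def if_not_P[OF \<open>p \<noteq> 1\<close>] c e by (rule sgn)
qed

text \<open>Reduces lower bounds for \<open>H p\<close> to the case \<open>p = 1\<close>. With
  \<open>b = 1 / p - 1\<close> the prefactor times \<open>b\<close> is exactly \<open>p\<close>, and
  \<open>exp y \<ge> 1 + y\<close> at \<open>y = b * ln x\<close> or \<open>y = - b * ln x\<close>
  extracts the logarithm.\<close>

lemma H_ge_log:
  assumes p: "0 < p" "p \<le> 1" and x: "0 < x"
  shows "p * ((x - 1) * ln x) \<le> H p x"
proof (cases "p = 1")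
  case True
  then show ?thesis by (simp add: H_def)
next
  case False
  with p have p1: "p < 1" by simp
  define b where "b = 1 / p - 1"
  have b: "0 < b" using p p1 by (simp add: b_def)
  have a: "1 / p = 1 + b" by (simp add: b_def)
  have "b * p = 1 - p" using p by (simp add: b_def field_simps)
  then have "p\<^sup>2 * b = p * (1 - p)" by (simp add: power2_eq_square mult.commute)
  then have c: "p\<^sup>2 / (1 - p) * b = p"
    using p p1 by (simp add: nonzero_divide_eq_eq)
  have "b * ((x - 1) * ln x) \<le> (x powr (1 + b) - 1) * (1 - x powr (- b))"
  proof (cases "1 \<le> x")
    case True
    have xb: "x powr b * x powr (-b) = 1" using x by (simp flip: powr_add)
    \<comment> \<open>The factor \<open>x powr b\<close> is shifted from the first bracket to the
      second, so that the brackets can be bounded separately by \<open>x - 1\<close> and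
      \<open>b * ln x\<close>.\<close>
    have "(x powr (1 + b) - 1) * (1 - x powr (- b)) =
        (x - x powr (-b)) * (x powr b - 1)"
      using x xb by (simp add: powr_add algebra_simps)
    moreover have "x powr (-b) \<le> 1"
      using True b powr_mono[of "-b" 0 x] by auto
    moreover have "b * ln x \<le> x powr b - 1"
      using x exp_ge_add_one_self[of "b * ln x"] by (simp add: powr_def del: exp_ge_add_one_self)
    moreover have "0 \<le> b * ln x" using True b by simp
    ultimately show ?thesis
      using mult_mono[of "x - 1" "x - x powr (-b)" "b * ln x" "x powr b - 1"] True
      by (simp add: mult.left_commute)
  next
    case False
    have "x powr (1 + b) \<le> x powr 1"
      using False b x by (intro powr_mono') auto
    then have "1 - x \<le> 1 - x powr (1 + b)" using x by simp
    moreover have "b * (- ln x) \<le> x powr (-b) - 1"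
      using x exp_ge_add_one_self[of "- b * ln x"] by (simp add: powr_def)
    moreover have "0 \<le> b * (- ln x)" using False b x by (intro mult_nonneg_nonneg) auto
    ultimately have "(1 - x) * (b * (- ln x)) \<le> (1 - x powr (1 + b)) * (x powr (-b) - 1)"
      using False by (intro mult_mono) auto
    then show ?thesis by (simp add: algebra_simps)
  qed
  then have "p\<^sup>2 / (1 - p) * (b * ((x - 1) * ln x)) \<le> H p x"
    unfolding H_eq[OF p(1) p1] a using p p1 by (intro mult_left_mono) auto
  then show ?thesis unfolding mult.assoc[symmetric] c .
qed

lemma H_nonneg:
  assumes "0 < p" "p \<le> 1" "0 < x"
  shows "0 \<le> H p x"
proof -
  have "0 \<le> (x - 1) * ln x"
    using assms by (cases "1 \<le> x") (auto simp: mult_nonpos_nonpos)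
  then show ?thesis using H_ge_log[OF assms] assms
    by (smt (verit) mult_nonneg_nonneg)
qed

lemma H_pos:
  assumes "0 < p" "p \<le> 1" "1 < x"
  shows "0 < H p x"
  using H_ge_log[OF assms(1,2), of x] assms by (smt (verit) mult_pos_pos ln_gt_zero)

text \<open>Lets the edge energy of \<open>g\<close> control the Dirichlet energy of its square
  root, to which the Poincare inequality is applied. With \<open>s = sqrt x\<close> it follows from
  \<open>1 - 1 / s \<le> ln s \<le> s - 1\<close>.\<close>

lemma H_ge_sqrt:
  assumes p: "0 < p" "p \<le> 1" and x: "0 < x"
  shows "p * (sqrt x - 1)\<^sup>2 \<le> H p x"
proof -
  define s where "s = sqrt x"
  have s: "0 < s" "x = s\<^sup>2" using x by (simp_all add: s_def)
  have lns: "ln (s\<^sup>2) = 2 * ln s" using s(1) by (simp add: ln_realpow)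
  have "(s - 1)\<^sup>2 \<le> (s\<^sup>2 - 1) * ln (s\<^sup>2)"
  proof (cases "1 \<le> s")
    case True
    have "1 - 1 / s \<le> ln s" using s ln_le_minus_one[of "1 / s"] by (simp add: ln_div)
    then have "(s - 1) \<le> s * ln s" using s by (simp add: field_simps)
    then have "(s - 1) * (s - 1) \<le> (s - 1) * (s * ln s)" using True by (intro mult_left_mono) auto
    also have "\<dots> \<le> (s - 1) * ((s + 1) * (2 * ln s))"
      using True by (intro mult_left_mono mult_mono) auto
    also have "\<dots> = (s\<^sup>2 - 1) * ln (s\<^sup>2)" using s(1) unfolding lns by (simp add: power2_eq_square algebra_simps)
    finally show ?thesis by (simp add: power2_eq_square)
  next
    case False
    have l: "1 - s \<le> - ln s" using ln_le_minus_one[OF s(1)] by simp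
    have "(1 - s) * (1 - s) \<le> (1 - s) * (- ln s)" using l False by (intro mult_left_mono) auto
    also have "\<dots> \<le> (1 - s) * ((s + 1) * (2 * (- ln s)))"
      using False s l mult_mono[of 1 "s + 1" "- ln s" "2 * (- ln s)"] by (intro mult_left_mono) auto
    also have "\<dots> = (s\<^sup>2 - 1) * ln (s\<^sup>2)" using s(1) unfolding lns by (simp add: power2_eq_square algebra_simps)
    finally show ?thesis by (simp add: power2_eq_square algebra_simps)
  qed
  then have "p * (sqrt x - 1)\<^sup>2 \<le> p * ((x - 1) * ln x)"
    using p s unfolding s_def[symmetric] by (intro mult_left_mono) auto
  then show ?thesis using H_ge_log[OF p x] by linarith
qed

lemma H_ge_x_log:
  assumes p: "0 < p" "p \<le> 1" and x: "2 \<le> x"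
  shows "p / 2 * (x * ln x) \<le> H p x"
proof -
  have "x / 2 * ln x \<le> (x - 1) * ln x" using x by (intro mult_right_mono) auto
  then have "p * (x / 2 * ln x) \<le> p * ((x - 1) * ln x)" using p by (intro mult_left_mono) auto
  then show ?thesis using H_ge_log[OF p, of x] x by simp
qed

text \<open>On \<open>[1, 2]\<close> one factor of \<open>H p\<close> is bounded and the other is at
  most a multiple of \<open>ln x\<close>, while
  \<open>ln x \<le> x - 1 \<le> 2 * (1 - 1 / x)\<close>. The form \<open>1 - 1 / x\<close> is the
  weight \<open>w j\<close> of the staircase when \<open>x = T j / T (Suc j)\<close>.\<close>

lemma H_le_near_1:
  assumes p: "0 < p" "p \<le> 1"
  obtains K where "0 < K" "\<And>x. 1 \<le> x \<Longrightarrow> x \<le> 2 \<Longrightarrow> H p x \<le> K * (1 - 1 / x)"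
proof -
  have l: "0 \<le> ln x \<and> ln x \<le> 1 \<and> ln x \<le> 2 * (1 - 1 / x)" if "1 \<le> x" "x \<le> 2" for x :: real
  proof -
    have "0 \<le> (x - 1) * (2 - x)" using that by simp
    then have "x - 1 \<le> 2 * (1 - 1 / x)" using that by (simp add: field_simps)
    then show ?thesis using ln_le_minus_one[of x] that by auto
  qed
  show ?thesis
  proof (cases "p = 1")
    case True
    have "H p x \<le> 2 * (1 - 1 / x)" if x: "1 \<le> x" "x \<le> 2" for x :: real
    proof -
      have "(x - 1) * ln x \<le> 1 * ln x" using x by (intro mult_right_mono) auto
      then show ?thesis using l[OF x] True by (simp add: H_def)
    qed
    then show ?thesis by (intro that[of 2]) auto
  next
    case False
    with p have p1: "p < 1" by simp
    define b where "b = 1 / p - 1"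
    have b: "0 < b" using p p1 by (simp add: b_def)
    define K where "K = p\<^sup>2 / (1 - p) * (2 powr (1 / p) * (b * 2))"
    have "H p x \<le> K * (1 - 1 / x)" if x: "1 \<le> x" "x \<le> 2" for x :: real
    proof -
      have "1 - x powr (- b) \<le> b * ln x"
        using x exp_ge_add_one_self[of "- b * ln x"] by (simp add: powr_def)
      also have "\<dots> \<le> b * (2 * (1 - 1 / x))" using l[OF x] b by (intro mult_left_mono) auto
      finally have 1: "1 - x powr (- b) \<le> b * 2 * (1 - 1 / x)" by (simp only: mult.assoc)
      have "x powr (1 / p) \<le> 2 powr (1 / p)" using x p by (intro powr_mono2) auto
      then have "(x powr (1 / p) - 1) * (1 - x powr (- b)) \<le> 2 powr (1 / p) * (b * 2 * (1 - 1 / x))"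
        using 1 x p b powr_mono[of "-b" 0 x] by (intro mult_mono) auto
      then have "p\<^sup>2 / (1 - p) * ((x powr (1 / p) - 1) * (1 - x powr (- b)))
          \<le> p\<^sup>2 / (1 - p) * (2 powr (1 / p) * (b * 2 * (1 - 1 / x)))"
        using p1 by (intro mult_left_mono) auto
      then show ?thesis unfolding H_eq[OF p(1) p1] K_def b_def by (simp add: mult.assoc)
    qed
    moreover have "0 < K" unfolding K_def using p p1 b by simp
    ultimately show ?thesis using that by blast
  qed
qed

text \<open>On \<open>x \<ge> r\<close>, away from the zero of \<open>H p\<close> at 1,
  \<open>H p x / x\<close> is comparable to \<open>x powr (1 / p - 1)\<close>, or to
  \<open>ln x\<close> if \<open>p = 1\<close>; so lowering the argument by a factor \<open>r\<close>
  costs only a constant. For the logarithm, \<open>R \<le> r * x \<le> x * x\<close> is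
  used.\<close>

lemma H_ratio_compare:
  assumes p: "0 < p" "p \<le> 1" and r: "1 < r"
  obtains K where "0 < K"
    "\<And>R x. r\<^sup>2 \<le> R \<Longrightarrow> R / r \<le> x \<Longrightarrow> H p R / R \<le> K * (H p x / x)"
proof (cases "p = 1")
  case True
  define K where "K = 2 / (1 - 1 / r)"
  have "H p R / R \<le> K * (H p x / x)" if R: "r\<^sup>2 \<le> R" and x: "R / r \<le> x" for R x
  proof -
    have "0 < r * r" using r by simp
    then have R0: "0 < R" using R by (simp add: power2_eq_square)
    have "r \<le> R / r" using R r by (simp add: field_simps power2_eq_square)
    then have rx: "r \<le> x" using x by simp
    have "R \<le> r * x" using x r by (simp add: field_simps)
    also have "\<dots> \<le> x * x" using rx r by (intro mult_right_mono) auto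
    finally have "ln R \<le> ln (x * x)" using R0 rx r by (subst ln_le_cancel_iff) auto
    then have lR: "ln R \<le> 2 * ln x" using rx r by (simp add: ln_mult)
    have "1 \<le> r\<^sup>2" using r by simp
    then have R1: "1 \<le> R" using R by linarith
    have "H p R / R = (1 - 1 / R) * ln R" using True R0 by (simp add: H_def field_simps)
    also have "\<dots> \<le> 1 * ln R" using R1 by (intro mult_right_mono) auto
    also have "\<dots> \<le> 2 * ln x" using lR by simp
    also have "\<dots> = K * ((1 - 1 / r) * ln x)" using r by (simp add: K_def field_simps)
    also have "\<dots> \<le> K * ((1 - 1 / x) * ln x)"
      using r rx by (intro mult_left_mono mult_right_mono) (auto simp: K_def field_simps)
    also have "(1 - 1 / x) * ln x = H p x / x" using True r rx by (simp add: H_def field_simps)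
    finally show ?thesis .
  qed
  moreover have "0 < K" using r by (simp add: K_def field_simps)
  ultimately show ?thesis using that by blast
next
  case False
  with p have p1: "p < 1" by simp
  define b where "b = 1 / p - 1"
  have b: "0 < b" using p p1 by (simp add: b_def)
  have a: "1 / p = 1 + b" by (simp add: b_def)
  define c where "c = p\<^sup>2 / (1 - p)"
  have c: "0 < c" using p p1 by (simp add: c_def)
  define q where "q = (1 - r powr (- (1 + b))) * (1 - r powr (- b))"
  have less1: "r powr (- (1 + b)) < 1" "r powr (- b) < 1"
    using r b powr_less_mono[of "- (1 + b)" 0 r] powr_less_mono[of "- b" 0 r] by auto
  then have q: "0 < q" by (simp add: q_def)
  have eq: "H p x / x = c * (x powr b * ((1 - x powr (- (1 + b))) * (1 - x powr (- b))))"
    if "0 < x" for x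
  proof -
    have "x powr (1 + b) * x powr (- (1 + b)) = 1" using that by (simp flip: powr_add)
    moreover have "x powr (1 + b) = x * x powr b" using that by (simp add: powr_add)
    ultimately have "x powr (1 + b) - 1 = x * (x powr b * (1 - x powr (- (1 + b))))"
      by (simp add: algebra_simps)
    then show ?thesis using that
      unfolding H_eq[OF p(1) p1] b_def[symmetric] c_def[symmetric] a by simp
  qed
  define K where "K = r powr b / q"
  have "H p R / R \<le> K * (H p x / x)" if R: "r\<^sup>2 \<le> R" and x: "R / r \<le> x" for R x
  proof -
    have "0 < r * r" using r by simp
    then have R0: "0 < R" using R by (simp add: power2_eq_square)
    have "1 \<le> r\<^sup>2" using r by simp
    then have R1: "1 \<le> R" using R by linarith
    have "r \<le> R / r" using R r by (simp add: field_simps power2_eq_square)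
    then have rx: "r \<le> x" using x by simp
    have "R powr (- (1 + b)) \<le> 1" "R powr (- b) \<le> 1"
      using R1 b powr_mono[of "- (1 + b)" 0 R] powr_mono[of "- b" 0 R] by auto
    then have "(1 - R powr (- (1 + b))) * (1 - R powr (- b)) \<le> 1 * 1"
      by (intro mult_mono) auto
    then have "R powr b * ((1 - R powr (- (1 + b))) * (1 - R powr (- b))) \<le> R powr b"
      by (simp add: mult_left_le)
    also have "R powr b \<le> (r * x) powr b" using x r R0 b
      by (intro powr_mono2) (auto simp: field_simps)
    also have "(r * x) powr b = K * (x powr b * q)" using r rx q by (simp add: K_def powr_mult)
    also have "\<dots> \<le> K * (x powr b * ((1 - x powr (- (1 + b))) * (1 - x powr (- b))))"
      unfolding q_def using r rx b less1 q powr_mono[of "-1-b" 0 x] powr_mono[of "-b" 0 x]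
      by (intro mult_left_mono mult_mono diff_left_mono powr_mono2')
         (auto simp: K_def)
    finally have "c * (R powr b * ((1 - R powr (- (1 + b))) * (1 - R powr (- b)))) \<le>
        c * (K * (x powr b * ((1 - x powr (- (1 + b))) * (1 - x powr (- b)))))"
      using c by (intro mult_left_mono) auto
    then show ?thesis using eq[OF R0] eq[of x] r rx by (simp add: mult.left_commute)
  qed
  moreover have "0 < K" using r q by (simp add: K_def)
  ultimately show ?thesis using that by blast
qed

section \<open>Edge energies\<close>

text \<open>The energy in terms of \<open>g = f\<^sup>p\<close>: up to the factor \<open>C / 4\<close>, the right-hand side of
  \<open>p\<close>-LS is the sum of these edge energies for every \<open>p \<in> (0, 1]\<close>.\<close>

definition edge_energy :: "real \<Rightarrow> nat pmf \<Rightarrow> (nat \<Rightarrow> real) \<Rightarrow> nat \<Rightarrow> real" where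
  "edge_energy p \<mu> g k = g k * H p (g (Suc k) / g k) * pmf \<mu> k"

lemma edge_energy_nonneg:
  assumes "0 < p" "p \<le> 1" "\<And>k. 0 < g k"
  shows "0 \<le> edge_energy p \<mu> g k"
  unfolding edge_energy_def using assms
  by (intro mult_nonneg_nonneg H_nonneg) (auto intro: less_imp_le)

lemma edge_energy_1:
  assumes "\<And>k. 0 < f k"
  shows "edge_energy 1 \<mu> f k = fwd_diff f k * fwd_diff (\<lambda>k. ln (f k)) k * pmf \<mu> k"
proof -
  have "f k * (f (Suc k) / f k - 1) = f (Suc k) - f k"
    using assms[of k] by (simp add: field_simps)
  then show ?thesis
    using assms[of k] assms[of "Suc k"]
    by (simp add: edge_energy_def H_def fwd_diff_def ln_div flip: mult.assoc)
qed

text \<open>Splitting \<open>u powr p\<close> as \<open>u * u powr (p - 1)\<close> gives one piece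
  to each factor of \<open>H p\<close>; the powers inside \<open>H p\<close> turn the ratio of the
  \<open>p\<close>-th powers into the ratios of \<open>f\<close> and of
  \<open>f powr (p - 1)\<close>.\<close>

lemma edge_energy_powr:
  assumes p: "0 < p" "p < 1" and f: "\<And>k. 0 < f k"
  shows "edge_energy p \<mu> (\<lambda>k. f k powr p) k =
    p\<^sup>2 / (p - 1) * (fwd_diff (\<lambda>k. f k powr (p - 1)) k * fwd_diff f k * pmf \<mu> k)"
proof -
  define u v where "u = f k" and "v = f (Suc k)"
  have uv: "0 < u" "0 < v" using f by (simp_all add: u_def v_def)
  have e1: "(v powr p / u powr p) powr (1 / p) = v / u"
    using uv p by (simp add: powr_divide powr_powr)
  have "p * (- (1 / p - 1)) = p - 1" using p by (simp add: field_simps)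
  then have e2: "(v powr p / u powr p) powr (- (1 / p - 1)) = v powr (p - 1) / u powr (p - 1)"
    using uv by (simp add: powr_divide powr_powr)
  have e3: "u powr p = u * u powr (p - 1)" using uv by (simp add: powr_mult_base)
  have "u * x * ((v / u - 1) * (1 - y / x)) = (v - u) * (x - y)" if "0 < x" for x y
    using uv that by (simp add: field_simps)
  from this[of "u powr (p - 1)" "v powr (p - 1)"]
  have e4: "u powr p * ((v / u - 1) * (1 - v powr (p - 1) / u powr (p - 1))) =
      (v - u) * (u powr (p - 1) - v powr (p - 1))"
    using uv unfolding e3 by simp
  have e5: "p\<^sup>2 / (p - 1) = - (p\<^sup>2 / (1 - p))"
    by (metis minus_diff_eq minus_divide_right)
  have "u powr p * (p\<^sup>2 / (1 - p) * ((v / u - 1) * (1 - v powr (p - 1) / u powr (p - 1)))) =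
      p\<^sup>2 / (p - 1) * ((v powr (p - 1) - u powr (p - 1)) * (v - u))"
    by (subst mult.left_commute) (simp only: e4 e5, simp add: algebra_simps)
  then show ?thesis
    unfolding edge_energy_def H_eq[OF p] fwd_diff_def u_def[symmetric] v_def[symmetric] e1 e2
      Suc_eq_plus1[symmetric]
    by simp
qed

text \<open>Ensures that the \<open>suminf\<close> on the right of \<open>p\<close>-LS is the limit
  of a convergent series, so that its partial sums are bounded by it.\<close>

lemma edge_energy_summable:
  assumes p: "0 < p" "p \<le> 1" and f: "f \<in> dirichlet_dom_pos \<mu>"
    and dom: "if p = 1 then (\<lambda>k. ln (f k)) \<in> dirichlet_dom \<mu>
       else (\<lambda>k. f k powr (p - 1)) \<in> dirichlet_dom_pos \<mu>"
  shows "summable (edge_energy p \<mu> (\<lambda>k. f k powr p))"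
proof (cases "p = 1")
  case True
  have "(\<lambda>k. f k powr p) = f"
    using f by (auto simp: dirichlet_dom_pos_def less_imp_le True)
  moreover have "edge_energy p \<mu> f = (\<lambda>k. fwd_diff f k * fwd_diff (\<lambda>k. ln (f k)) k * pmf \<mu> k)"
    using f edge_energy_1[of f \<mu>] by (auto simp: dirichlet_dom_pos_def True)
  ultimately show ?thesis
    using f dom by (simp add: True dirichlet_form_summable dirichlet_dom_pos_def)
next
  case False
  with p have p1: "p < 1" by simp
  have "edge_energy p \<mu> (\<lambda>k. f k powr p) = (\<lambda>k. p\<^sup>2 / (p - 1) *
      (fwd_diff (\<lambda>k. f k powr (p - 1)) k * fwd_diff f k * pmf \<mu> k))"
    using f edge_energy_powr[OF p(1) p1, of f \<mu>] by (auto simp: dirichlet_dom_pos_def)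
  moreover have "summable (\<lambda>k. fwd_diff (\<lambda>k. f k powr (p - 1)) k * fwd_diff f k * pmf \<mu> k)"
    using f dom False by (intro dirichlet_form_summable) (auto simp: dirichlet_dom_pos_def)
  ultimately show ?thesis by (simp only: summable_mult)
qed

text \<open>Gives both cases of \<open>p\<close>-LS the same inequality; they then differ only in
  the domain condition.\<close>

lemma log_sobolev_iff:
  assumes p: "0 < p" "p \<le> 1"
  shows "log_sobolev p \<mu> C \<longleftrightarrow>
    (\<forall>f \<in> dirichlet_dom_pos \<mu>.
      (if p = 1 then (\<lambda>k. ln (f k)) \<in> dirichlet_dom \<mu>
       else (\<lambda>k. f k powr (p - 1)) \<in> dirichlet_dom_pos \<mu>) \<longrightarrow>
      Ent \<mu> (\<lambda>k. f k powr p) \<le> C / 4 * (\<Sum>k. edge_energy p \<mu> (\<lambda>k. f k powr p) k))"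
proof (cases "p = 1")
  case True
  have "(\<lambda>k. f k powr p) = f" if "f \<in> dirichlet_dom_pos \<mu>" for f
    using that by (auto simp: dirichlet_dom_pos_def less_imp_le True)
  moreover have "edge_energy p \<mu> f = (\<lambda>k. fwd_diff f k * fwd_diff (\<lambda>k. ln (f k)) k * pmf \<mu> k)"
    if "f \<in> dirichlet_dom_pos \<mu>" for f
    using that edge_energy_1[of f \<mu>] by (auto simp: dirichlet_dom_pos_def True)
  ultimately show ?thesis
    unfolding log_sobolev_def dirichlet_form_def if_P[OF True] by simp
next
  case False
  with p have p1: "p < 1" by simp
  have "C / 4 * (\<Sum>k. edge_energy p \<mu> (\<lambda>k. f k powr p) k) =
      C * p\<^sup>2 / (4 * (p - 1)) * dirichlet_form \<mu> (\<lambda>k. f k powr (p - 1)) f"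
    if f: "f \<in> dirichlet_dom_pos \<mu>" "(\<lambda>k. f k powr (p - 1)) \<in> dirichlet_dom_pos \<mu>" for f
  proof -
    have e: "edge_energy p \<mu> (\<lambda>k. f k powr p) = (\<lambda>k. p\<^sup>2 / (p - 1) *
        (fwd_diff (\<lambda>k. f k powr (p - 1)) k * fwd_diff f k * pmf \<mu> k))"
      using f edge_energy_powr[OF p(1) p1, of f \<mu>] by (auto simp: dirichlet_dom_pos_def)
    have s: "summable (\<lambda>k. fwd_diff (\<lambda>k. f k powr (p - 1)) k * fwd_diff f k * pmf \<mu> k)"
      using f by (intro dirichlet_form_summable) (auto simp: dirichlet_dom_pos_def)
    show ?thesis unfolding e dirichlet_form_def
      using suminf_mult[OF s, of "p\<^sup>2 / (p - 1)"] by simp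
  qed
  then show ?thesis
    unfolding log_sobolev_def if_not_P[OF False] by metis
qed

text \<open>For values in an interval away from 0 the function \<open>g powr (1 / p)\<close> is
  bounded, and so is its logarithm or its power with the negative exponent \<open>p - 1\<close>; the
  domain conditions are therefore automatic.\<close>

lemma log_sobolev_bounded:
  assumes p: "0 < p" "p \<le> 1" and LS: "log_sobolev p \<mu> C"
    and a: "0 < a" and g: "\<And>k. a \<le> g k" "\<And>k. g k \<le> b"
  shows "Ent \<mu> g \<le> C / 4 * (\<Sum>k. edge_energy p \<mu> g k)"
proof -
  define f where "f k = g k powr (1 / p)" for k
  have g0: "0 < g k" for k using a g(1)[of k] by linarith
  have fp: "(\<lambda>k. f k powr p) = g"
    using p g0 by (auto simp: f_def powr_powr less_imp_le)
  have f0: "0 < f k" for k using g0[of k] by (simp add: f_def)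
  have "f \<in> dirichlet_dom \<mu>"
    by (rule bounded_in_dirichlet_dom[of _ "b powr (1 / p)"])
       (use g0 g p in \<open>auto simp: f_def intro!: powr_mono2 intro: less_imp_le\<close>)
  then have 1: "f \<in> dirichlet_dom_pos \<mu>" using f0 by (auto simp: dirichlet_dom_pos_def)
  have "(\<lambda>k. ln (f k)) \<in> dirichlet_dom \<mu>" if "p = 1"
  proof (rule bounded_in_dirichlet_dom)
    fix k
    have "ln a \<le> ln (g k)" "ln (g k) \<le> ln b" using a g[of k] g0[of k] by auto
    then show "\<bar>ln (f k)\<bar> \<le> \<bar>ln a\<bar> + \<bar>ln b\<bar>" using that g0[of k] by (simp add: f_def)
  qed
  moreover have "(\<lambda>k. f k powr (p - 1)) \<in> dirichlet_dom_pos \<mu>" if "p \<noteq> 1"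
  proof -
    have "(\<lambda>k. f k powr (p - 1)) \<in> dirichlet_dom \<mu>"
    proof (rule bounded_in_dirichlet_dom)
      fix k
      have "a powr (1 / p) \<le> f k" using a g(1)[of k] p unfolding f_def by (intro powr_mono2) auto
      then have "f k powr (p - 1) \<le> (a powr (1 / p)) powr (p - 1)"
        using a p by (intro powr_mono2') auto
      then show "\<bar>f k powr (p - 1)\<bar> \<le> (a powr (1 / p)) powr (p - 1)" by simp
    qed
    then show ?thesis using f0 by (auto simp: dirichlet_dom_pos_def less_imp_neq[THEN not_sym])
  qed
  ultimately have "if p = 1 then (\<lambda>k. ln (f k)) \<in> dirichlet_dom \<mu>
      else (\<lambda>k. f k powr (p - 1)) \<in> dirichlet_dom_pos \<mu>" by simp
  then show ?thesis
    using LS 1 unfolding log_sobolev_iff[OF p] by (metis fp)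
qed

section \<open>Failure of the inequality\<close>

text \<open>Recursion on the number of jumps makes each step add one multiple of a half-line
  indicator, so that means and energies follow by induction on \<open>N\<close>.\<close>

primrec staircase :: "(nat \<Rightarrow> real) \<Rightarrow> (nat \<Rightarrow> nat) \<Rightarrow> nat \<Rightarrow> nat \<Rightarrow> real" where
  "staircase T \<tau> 0 k = 1 / T 0"
| "staircase T \<tau> (Suc N) k = (if \<tau> (Suc N) \<le> k then 1 / T (Suc N) else staircase T \<tau> N k)"

context
  fixes \<mu> :: "nat pmf" and \<tau> :: "nat \<Rightarrow> nat" and T :: "nat \<Rightarrow> real"
  assumes full: "set_pmf \<mu> = UNIV" and \<tau>: "strict_mono \<tau>"
  defines "T \<equiv> \<lambda>j. tail \<mu> (\<tau> j)"
begin

lemma tail_level_pos: "0 < T j"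
  using pmf_le_tail[of \<mu> "\<tau> j"] full pmf_positive[of "\<tau> j" \<mu>] by (simp add: T_def)

lemma tail_level_Suc: "T (Suc j) < T j"
proof -
  have "\<tau> j < \<tau> (Suc j)" using \<tau> by (simp add: strict_mono_Suc_iff)
  then have "T (Suc j) \<le> tail \<mu> (Suc (\<tau> j))" unfolding T_def by (intro tail_antimono) simp
  also have "\<dots> < T j" using tail_Suc[of \<mu> "\<tau> j"] full pmf_positive[of "\<tau> j" \<mu>]
    by (simp add: T_def)
  finally show ?thesis .
qed

lemma tail_level_le_1: "T j \<le> 1"
  by (simp add: T_def tail_le_1)

lemma staircase_above: "\<tau> N \<le> k \<Longrightarrow> staircase T \<tau> N k = 1 / T N"
  by (cases N) auto

lemma staircase_bounds: "1 / T 0 \<le> staircase T \<tau> N k \<and> staircase T \<tau> N k \<le> 1 / T N"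
proof (induction N)
  case (Suc N)
  have "1 / T N \<le> 1 / T (Suc N)"
    using tail_level_pos tail_level_Suc[of N] by (intro divide_left_mono) (auto simp: less_imp_le)
  then show ?case using Suc by auto
qed auto

text \<open>Summation by parts: the last step adds the jump of \<open>F\<close> on the half-line
  from \<open>\<tau> (Suc N)\<close>, which has mass \<open>T (Suc N)\<close>.\<close>

lemma staircase_expectation:
  fixes F :: "real \<Rightarrow> real"
  assumes F: "\<And>N. integrable (measure_pmf \<mu>) (\<lambda>k. F (staircase T \<tau> N k))"
  shows "measure_pmf.expectation \<mu> (\<lambda>k. F (staircase T \<tau> N k)) =
    F (1 / T 0) + (\<Sum>j<N. (F (1 / T (Suc j)) - F (1 / T j)) * T (Suc j))"
proof (induction N)
  case (Suc N)
  have "\<tau> N < \<tau> (Suc N)" using \<tau> by (simp add: strict_mono_Suc_iff)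
  then have "(\<lambda>k. F (staircase T \<tau> (Suc N) k)) = (\<lambda>k. F (staircase T \<tau> N k) +
      (F (1 / T (Suc N)) - F (1 / T N)) * indicator {\<tau> (Suc N)..} k)"
    by (auto simp: staircase_above)
  moreover have "integrable (measure_pmf \<mu>)
      (\<lambda>k. (F (1 / T (Suc N)) - F (1 / T N)) * indicator {\<tau> (Suc N)..} k)"
    by (intro measure_pmf.integrable_const_bound[of _ "\<bar>F (1 / T (Suc N)) - F (1 / T N)\<bar>"])
       (auto simp: indicator_def)
  moreover have "measure_pmf.prob \<mu> {\<tau> (Suc N)..} = T (Suc N)" by (simp add: T_def tail_def)
  ultimately show ?case using Suc F[of N] by simp
qed simp

text \<open>Flat edges cost nothing since \<open>H p 1 = 0\<close>. The remaining edges start at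
  \<open>\<tau> (Suc j) - 1\<close>, a true predecessor because
  \<open>\<tau> j < \<tau> (Suc j)\<close>, and there the value is still
  \<open>1 / T j\<close>.\<close>

lemma staircase_energy:
  "edge_energy p \<mu> (staircase T \<tau> N) sums
    (\<Sum>j<N. 1 / T j * H p (T j / T (Suc j)) * pmf \<mu> (\<tau> (Suc j) - 1))"
proof (induction N)
  case 0
  have "edge_energy p \<mu> (staircase T \<tau> 0) = (\<lambda>k. 0)"
    using tail_level_pos[of 0] by (auto simp: edge_energy_def H_1)
  then show ?case by (simp only: sums_zero lessThan_0 sum.empty)
next
  case (Suc N)
  have lt: "\<tau> N < \<tau> (Suc N)" using \<tau> by (simp add: strict_mono_Suc_iff)
  have pos: "T j \<noteq> 0" for j using tail_level_pos[of j] by simp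
  let ?q = "\<tau> (Suc N) - 1"
  let ?c = "1 / T N * H p (T N / T (Suc N)) * pmf \<mu> ?q"
  have "edge_energy p \<mu> (staircase T \<tau> (Suc N)) k =
      edge_energy p \<mu> (staircase T \<tau> N) k + (if k = ?q then ?c else 0)" for k
  proof -
    consider "Suc k < \<tau> (Suc N)" | "Suc k = \<tau> (Suc N)" | "\<tau> (Suc N) \<le> k" by linarith
    then show ?thesis
    proof cases
      case 1
      then show ?thesis by (auto simp: edge_energy_def)
    next
      case 2
      then have "\<tau> N \<le> k" "\<tau> N \<le> Suc k" "\<not> \<tau> (Suc N) \<le> k" "k = ?q" using lt by auto
      with 2 show ?thesis by (simp add: edge_energy_def staircase_above H_1 pos)
    next
      case 3
      with lt have "\<tau> N \<le> k" "\<tau> N \<le> Suc k" "k \<noteq> ?q" by auto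
      with 3 show ?thesis by (simp add: edge_energy_def staircase_above H_1 pos)
    qed
  qed
  then have "edge_energy p \<mu> (staircase T \<tau> (Suc N)) =
      (\<lambda>k. edge_energy p \<mu> (staircase T \<tau> N) k + (if k = ?q then ?c else 0))" by blast
  moreover have "(\<lambda>k. if k = ?q then ?c else 0) sums ?c" by (rule sums_single)
  ultimately show ?case using sums_add[OF Suc.IH, of "\<lambda>k. if k = ?q then ?c else 0" ?c]
    by (simp only: sum.lessThan_Suc)
qed

lemma log_sobolev_fails:
  assumes p: "0 < p" "p \<le> 1" and C: "0 < C"
    and lim: "filterlim (\<lambda>n. inverse (H p (T (n - 1) / T n)) *
      (T (n - 1) / tail \<mu> (\<tau> n - 1)) * ln (2 / T n)) at_top sequentially"
  shows "\<not> log_sobolev p \<mu> C"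
proof
  assume LS: "log_sobolev p \<mu> C"
  define w where "w j = 1 - T (Suc j) / T j" for j
  define L where "L j = ln (1 / T (Suc j))" for j
  \<comment> \<open>An upper bound for the energy of the \<open>j\<close>-th jump, with the mass at
    the site replaced by its tail; the expression in \<open>lim\<close> at \<open>n = Suc j\<close>
    is \<open>ln (2 / T (Suc j)) / h j\<close>.\<close>
  define h where "h j = H p (T j / T (Suc j)) * (tail \<mu> (\<tau> (Suc j) - 1) / T j)" for j
  define W where "W N = (\<Sum>j<N. w j)" for N
  define Q where "Q N = (\<Sum>j<N. w j * L j)" for N
  define c where "c = 1 / T 0"
  have c1: "1 \<le> c" using tail_level_pos[of 0] tail_level_le_1[of 0] by (simp add: c_def)
  have wpos: "0 < w j" "w j < 1" for j
    using tail_level_pos[of j] tail_level_pos[of "Suc j"] tail_level_Suc[of j]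
    by (simp_all add: w_def)
  have W0: "0 \<le> W N" for N unfolding W_def by (intro sum_nonneg) (use wpos in \<open>auto intro: less_imp_le\<close>)
  have T0: "T \<longlonglongrightarrow> 0"
    using filterlim_compose[OF tail_tendsto_0 filterlim_subseq[OF \<tau>]] by (simp add: T_def)
  have Tanti: "T (m + n) \<le> T m" for m n
  proof (induction n)
    case (Suc n)
    then show ?case using tail_level_Suc[of "m + n"] by simp
  qed simp
  \<comment> \<open>The series of the \<open>w j\<close> diverges: its partial sums beyond \<open>M\<close> dominate the telescoping
    sum of \<open>(T j - T (Suc j)) / T M\<close>, which tends to 1.\<close>
  have half: "\<exists>N\<ge>M. W M + 1 / 2 \<le> W N" for M
  proof -
    have "eventually (\<lambda>n. T n < T M / 2) sequentially"
      using T0 tail_level_pos[of M] by (intro order_tendstoD) auto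
    then obtain N' where N': "\<And>n. n \<ge> N' \<Longrightarrow> T n < T M / 2" by (auto simp: eventually_sequentially)
    have ge: "W M + (1 - T (M + n) / T M) \<le> W (M + n)" for n
    proof (induction n)
      case (Suc n)
      have "(T (M + n) - T (M + Suc n)) / T M \<le> (T (M + n) - T (M + Suc n)) / T (M + n)"
        using Tanti[of M n] tail_level_Suc[of "M + n"] tail_level_pos
        by (intro divide_left_mono) (auto simp: less_imp_le)
      also have "\<dots> = w (M + n)" using tail_level_pos[of "M + n"] by (simp add: w_def diff_divide_distrib)
      finally show ?case using Suc by (simp add: W_def diff_divide_distrib)
    qed (use tail_level_pos[of M] in simp)
    have "T (M + N') / T M < 1 / 2" using N'[of "M + N'"] tail_level_pos[of M] by (simp add: field_simps)
    then show ?thesis using ge[of N'] by (intro exI[of _ "M + N'"]) auto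
  qed
  have W_large: "\<exists>N. real n / 2 \<le> W N" for n
  proof (induction n)
    case 0
    show ?case using W0 by (intro exI[of _ 0]) (simp add: W_def)
  next
    case (Suc n)
    then obtain M where "real n / 2 \<le> W M" by blast
    moreover obtain N where "W M + 1 / 2 \<le> W N" using half by blast
    ultimately show ?case by (intro exI[of _ N]) (simp add: add_divide_distrib)
  qed
  have W_inf: "filterlim W at_top sequentially"
    unfolding filterlim_at_top
  proof
    fix Z
    obtain n where n: "2 * Z \<le> real n" using real_arch_simple by blast
    obtain N where "real n / 2 \<le> W N" using W_large by blast
    moreover have "W N \<le> W M" if "N \<le> M" for M
      unfolding W_def using that wpos by (intro sum_mono2) (auto intro: less_imp_le)
    ultimately show "eventually (\<lambda>M. Z \<le> W M) sequentially"
      using n by (intro eventually_sequentiallyI[of N]) (smt (verit) field_sum_of_halves)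
  qed
  \<comment> \<open>The inequality \<open>ln y \<le> y - 1\<close> bounds each \<open>w j\<close> by
    an increment of \<open>ln (1 / T j)\<close>; the sum telescopes.\<close>
  have L_ge: "W (Suc j) \<le> L j" for j
  proof -
    have w_le: "w j \<le> ln (1 / T (Suc j)) - ln (1 / T j)" for j
      using tail_level_pos[of j] tail_level_pos[of "Suc j"] ln_le_minus_one[of "T (Suc j) / T j"]
      by (simp add: w_def ln_div)
    have "W N \<le> ln (1 / T N) - ln (1 / T 0)" for N
    proof (induction N)
      case (Suc N)
      then show ?case using w_le[of N] by (simp add: W_def)
    qed (simp add: W_def)
    from this[of "Suc j"] ln_ge_zero[OF c1] show ?thesis by (simp only: L_def c_def)
  qed
  \<comment> \<open>A discrete form of integrating \<open>W dW\<close>: since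
    \<open>L N \<ge> W (Suc N)\<close>, each increment of \<open>Q\<close> is at least that of half
    the square of \<open>W\<close>.\<close>
  have Q_ge: "(W N)\<^sup>2 / 2 \<le> Q N" for N
  proof (induction N)
    case 0
    show ?case by (simp add: W_def Q_def)
  next
    case (Suc N)
    have WS: "W (Suc N) = W N + w N" by (simp add: W_def)
    have "w N * W (Suc N) \<le> w N * L N" using L_ge[of N] wpos[of N] by (intro mult_left_mono) auto
    moreover have "(W (Suc N))\<^sup>2 / 2 = (W N)\<^sup>2 / 2 + w N * W (Suc N) - (w N)\<^sup>2 / 2"
      unfolding WS by (simp add: power2_eq_square algebra_simps)
    moreover have "0 \<le> (w N)\<^sup>2" by simp
    moreover have "Q (Suc N) = Q N + w N * L N" by (simp add: Q_def)
    ultimately show ?case using Suc by linarith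
  qed
  \<comment> \<open>Chosen so that \<open>C / 4 * \<epsilon> = 1 / 2\<close>: the energy can then
    absorb only half of \<open>Q N\<close>.\<close>
  define \<epsilon> where "\<epsilon> = 2 / C"
  have \<epsilon>: "0 < \<epsilon>" using C by (simp add: \<epsilon>_def)
  have Hpos: "0 < H p (T j / T (Suc j))" for j
    using tail_level_pos[of "Suc j"] tail_level_Suc[of j] by (intro H_pos p) simp
  have hpos: "0 < h j" for j
  proof -
    have "T (Suc j) \<le> tail \<mu> (\<tau> (Suc j) - 1)" unfolding T_def by (intro tail_antimono) simp
    then show ?thesis unfolding h_def
      using Hpos[of j] tail_level_pos[of "Suc j"] tail_level_pos[of j] by (intro mult_pos_pos divide_pos_pos) auto
  qed
  \<comment> \<open>If the tail at least halves, then \<open>w j \<ge> 1 / 2\<close>, and the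
    threshold \<open>2 / \<epsilon>\<close> compensates for this factor. Otherwise
    \<open>h j \<le> K * w j\<close>, and the logarithm exceeds \<open>K / \<epsilon>\<close>
    because it dominates the divergent \<open>W (Suc j)\<close>.\<close>
  have h_le: "eventually (\<lambda>j. h j \<le> \<epsilon> * (w j * ln (2 / T (Suc j)))) sequentially"
  proof -
    obtain K where K: "0 < K" "\<And>x. 1 \<le> x \<Longrightarrow> x \<le> 2 \<Longrightarrow> H p x \<le> K * (1 - 1 / x)"
      using H_le_near_1[OF p] by blast
    have "filterlim (\<lambda>j. inverse (H p (T (Suc j - 1) / T (Suc j))) *
        (T (Suc j - 1) / tail \<mu> (\<tau> (Suc j) - 1)) * ln (2 / T (Suc j))) at_top sequentially"
      using lim by (rule filterlim_compose) (rule filterlim_Suc)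
    then have "filterlim (\<lambda>j. ln (2 / T (Suc j)) / h j) at_top sequentially"
      by (simp add: h_def divide_inverse mult_ac)
    then have ev1: "eventually (\<lambda>j. 2 / \<epsilon> \<le> ln (2 / T (Suc j)) / h j) sequentially"
      by (auto simp: filterlim_at_top)
    have "filterlim (\<lambda>j. W (Suc j)) at_top sequentially"
      using W_inf by (rule filterlim_compose) (rule filterlim_Suc)
    then have ev2: "eventually (\<lambda>j. K / \<epsilon> \<le> W (Suc j)) sequentially"
      by (auto simp: filterlim_at_top)
    show ?thesis using ev1 ev2
    proof eventually_elim
      case (elim j)
      let ?l = "ln (2 / T (Suc j))"
      have lL: "L j \<le> ?l" using tail_level_pos[of "Suc j"] by (simp add: L_def divide_right_mono)
      have l0: "0 \<le> ?l" using L_ge[of j] W0[of "Suc j"] lL by linarith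
      show ?case
      proof (cases "2 \<le> T j / T (Suc j)")
        case True
        then have w: "1 / 2 \<le> w j"
          using tail_level_pos[of j] tail_level_pos[of "Suc j"] by (simp add: w_def field_simps)
        have "h j \<le> \<epsilon> * (1 / 2 * ?l)" using elim(1) \<epsilon> hpos[of j] by (simp add: field_simps)
        also have "\<dots> \<le> \<epsilon> * (w j * ?l)"
          using w l0 \<epsilon> by (intro mult_left_mono mult_right_mono) auto
        finally show ?thesis .
      next
        case False
        have "\<tau> j < \<tau> (Suc j)" using \<tau> by (simp add: strict_mono_Suc_iff)
        then have "tail \<mu> (\<tau> (Suc j) - 1) \<le> T j" unfolding T_def by (intro tail_antimono) simp
        then have "h j \<le> H p (T j / T (Suc j)) * 1" unfolding h_def
          using Hpos[of j] tail_level_pos[of j] by (intro mult_left_mono) auto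
        also have "\<dots> \<le> K * w j"
          using K(2)[of "T j / T (Suc j)"] False tail_level_Suc[of j] tail_level_pos[of "Suc j"]
          by (simp add: w_def)
        also have "\<dots> \<le> \<epsilon> * W (Suc j) * w j"
          using elim(2) \<epsilon> wpos[of j] by (intro mult_right_mono) (auto simp: field_simps)
        also have "\<dots> \<le> \<epsilon> * ?l * w j"
          using L_ge[of j] lL \<epsilon> wpos[of j] by (intro mult_right_mono mult_left_mono) auto
        finally show ?thesis by (simp add: mult_ac)
      qed
    qed
  qed
  then obtain N0 where N0: "\<And>j. N0 \<le> j \<Longrightarrow> h j \<le> \<epsilon> * (w j * ln (2 / T (Suc j)))"
    by (auto simp: eventually_sequentially)
  have ln2T: "ln (2 / T (Suc j)) = ln 2 + L j" for j
    using tail_level_pos[of "Suc j"] by (simp add: L_def ln_div)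
  have L0: "0 \<le> L j" for j using L_ge[of j] W0[of "Suc j"] by linarith
  \<comment> \<open>The energy of the finitely many jumps not covered by the asymptotic bound; it is
    independent of \<open>N\<close>.\<close>
  define D where "D = (\<Sum>j<N0. h j)"
  have sum_h: "(\<Sum>j<N. h j) \<le> D + \<epsilon> * (W N * ln 2 + Q N)" for N
  proof -
    have "(\<Sum>j<N. h j) \<le> (\<Sum>j<N. (if j < N0 then h j else 0) + \<epsilon> * (w j * (ln 2 + L j)))"
    proof (rule sum_mono)
      fix j
      have "0 \<le> \<epsilon> * (w j * (ln 2 + L j))" using \<epsilon> wpos[of j] L0[of j]
        by (intro mult_nonneg_nonneg add_nonneg_nonneg) auto
      then show "h j \<le> (if j < N0 then h j else 0) + \<epsilon> * (w j * (ln 2 + L j))"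
        using N0[of j] ln2T[of j] by auto
    qed
    also have "\<dots> = (\<Sum>j<N. if j < N0 then h j else 0) + \<epsilon> * (W N * ln 2 + Q N)"
      by (simp add: sum.distrib W_def Q_def sum_distrib_left distrib_left sum_distrib_right mult.assoc)
    also have "(\<Sum>j<N. if j < N0 then h j else 0) \<le> (\<Sum>j<max N N0. if j < N0 then h j else 0)"
      using hpos by (intro sum_mono2) (auto intro: less_imp_le)
    also have "(\<Sum>j<max N N0. if j < N0 then h j else 0) = D"
    proof -
      have "{j \<in> {..<max N N0}. j < N0} = {..<N0}" by auto
      then show ?thesis unfolding D_def by (simp flip: sum.inter_filter)
    qed
    finally show ?thesis by simp
  qed
  have bound: "Q N / 2 \<le> C * D / 4 + W N + (c + W N) * ln (c + W N)" for N
  proof -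
    let ?g = "staircase T \<tau> N"
    \<comment> \<open>A staircase takes its values in a compact subinterval of the positive axis,
      where a continuous \<open>F\<close> is bounded.\<close>
    have int: "integrable (measure_pmf \<mu>) (\<lambda>k. F (staircase T \<tau> N k))"
      if "continuous_on {0<..} F" for N and F :: "real \<Rightarrow> real"
    proof -
      have sub: "{a..b} \<subseteq> {0<..}" if "0 < a" for a b :: real using that by auto
      have "{1 / T 0..1 / T N} \<subseteq> {0<..}" by (intro sub) (use tail_level_pos in simp)
      then have "compact (F ` {1 / T 0..1 / T N})"
        by (intro compact_continuous_image continuous_on_subset[OF that] compact_Icc)
      then have "bounded (F ` {1 / T 0..1 / T N})" by (rule compact_imp_bounded)
      then obtain B where "\<And>y. y \<in> F ` {1 / T 0..1 / T N} \<Longrightarrow> norm y \<le> B"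
        unfolding bounded_iff by blast
      then have "norm (F (staircase T \<tau> N k)) \<le> B" for k using staircase_bounds[of N k] by auto
      then show ?thesis
        by (intro measure_pmf.integrable_const_bound[of _ B]) auto
    qed
    have ex: "measure_pmf.expectation \<mu> ?g = c + W N"
    proof -
      have "measure_pmf.expectation \<mu> ?g = c + (\<Sum>j<N. (1 / T (Suc j) - 1 / T j) * T (Suc j))"
        using staircase_expectation[of "\<lambda>x. x" N] int[of "\<lambda>x. x"] by (simp add: c_def)
      also have "(\<Sum>j<N. (1 / T (Suc j) - 1 / T j) * T (Suc j)) = W N"
        unfolding W_def by (intro sum.cong refl) (simp add: w_def left_diff_distrib
          less_imp_neq[OF tail_level_pos, THEN not_sym])
      finally show ?thesis .
    qed
    have "Q N \<le> measure_pmf.expectation \<mu> (\<lambda>k. ?g k * ln (?g k))"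
    proof -
      have "measure_pmf.expectation \<mu> (\<lambda>k. ?g k * ln (?g k)) =
          c * ln c + (\<Sum>j<N. (1 / T (Suc j) * ln (1 / T (Suc j)) - 1 / T j * ln (1 / T j)) * T (Suc j))"
        unfolding c_def
        by (rule staircase_expectation[of "\<lambda>x. x * ln x" N], rule int) (auto intro!: continuous_intros)
      moreover have "Q N \<le> (\<Sum>j<N. (1 / T (Suc j) * ln (1 / T (Suc j)) - 1 / T j * ln (1 / T j)) * T (Suc j))"
        unfolding Q_def
      proof (rule sum_mono)
        fix j
        \<comment> \<open>Replacing the smaller logarithm \<open>ln (1 / T j)\<close> by
          \<open>L j\<close> lets \<open>L j\<close> factor out of the difference, and the remaining
          coefficient is \<open>w j\<close>.\<close>
        have "ln (1 / T j) \<le> L j" unfolding L_def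
          using tail_level_pos[of j] tail_level_pos[of "Suc j"] tail_level_Suc[of j]
          by (simp add: ln_div)
        then have "1 / T j * ln (1 / T j) \<le> 1 / T j * L j"
          using tail_level_pos[of j] by (intro mult_left_mono) auto
        then have "(1 / T (Suc j) * L j - 1 / T j * L j) * T (Suc j) \<le>
            (1 / T (Suc j) * L j - 1 / T j * ln (1 / T j)) * T (Suc j)"
          using tail_level_pos[of "Suc j"] by (intro mult_right_mono) auto
        moreover have "(1 / T (Suc j) * L j - 1 / T j * L j) * T (Suc j) = w j * L j"
          using tail_level_pos[of "Suc j"] by (simp add: w_def field_simps)
        ultimately show "w j * L j \<le>
            (1 / T (Suc j) * ln (1 / T (Suc j)) - 1 / T j * ln (1 / T j)) * T (Suc j)"
          by (simp add: L_def)
      qed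
      moreover have "0 \<le> c * ln c" using c1 by simp
      ultimately show ?thesis by linarith
    qed
    then have "Q N - (c + W N) * ln (c + W N) \<le> Ent \<mu> ?g" by (simp add: Ent_def ex)
    also have "\<dots> \<le> C / 4 * (\<Sum>k. edge_energy p \<mu> ?g k)"
      using staircase_bounds tail_level_pos[of 0]
      by (intro log_sobolev_bounded[OF p LS, of "1 / T 0" _ "1 / T N"]) auto
    also have "\<dots> \<le> C / 4 * (\<Sum>j<N. h j)"
    proof -
      have "(\<Sum>k. edge_energy p \<mu> ?g k) =
          (\<Sum>j<N. 1 / T j * H p (T j / T (Suc j)) * pmf \<mu> (\<tau> (Suc j) - 1))"
        using staircase_energy by (rule sums_unique[symmetric])
      also have "\<dots> \<le> (\<Sum>j<N. 1 / T j * H p (T j / T (Suc j)) * tail \<mu> (\<tau> (Suc j) - 1))"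
        using tail_level_pos Hpos
        by (intro sum_mono mult_left_mono pmf_le_tail mult_nonneg_nonneg) (auto intro: less_imp_le)
      finally show ?thesis using C by (intro mult_left_mono) (auto simp: h_def mult_ac)
    qed
    also have "\<dots> \<le> C / 4 * (D + \<epsilon> * (W N * ln 2 + Q N))"
      using sum_h C by (intro mult_left_mono) auto
    also have "\<dots> = C * D / 4 + (W N * ln 2 + Q N) / 2" using C by (simp add: \<epsilon>_def field_simps)
    finally have "Q N / 2 \<le> C * D / 4 + W N * ln 2 / 2 + (c + W N) * ln (c + W N)" 
      by (simp add: add_divide_distrib)
    moreover have "W N * ln 2 \<le> W N * 1"
      using W0[of N] ln_le_minus_one[of 2] by (intro mult_left_mono) auto
    ultimately show ?thesis using W0[of N] by linarith
  qed
  define B where "B = C * D / 4"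
  \<comment> \<open>By \<open>Q_ge\<close> the left side of \<open>bound\<close> grows at least like
    a quarter of the square of \<open>W\<close>, its right side only like
    \<open>W * ln W\<close>.\<close>
  have "eventually (\<lambda>x::real. B + x + (c + x) * ln (c + x) < x\<^sup>2 / 4) at_top"
    by real_asymp
  then have "eventually (\<lambda>N. B + W N + (c + W N) * ln (c + W N) < (W N)\<^sup>2 / 4) sequentially"
    using W_inf by (rule eventually_compose_filterlim)
  then obtain N where "B + W N + (c + W N) * ln (c + W N) < (W N)\<^sup>2 / 4"
    using eventually_happens'[OF sequentially_bot] by blast
  then show False using bound[of N] Q_ge[of N] by (simp add: B_def)
qed

end

section \<open>Validity of the inequality\<close>

text \<open>The indicator of \<open>{Suc k..}\<close> changes only across the edge at
  \<open>k\<close>, so its energy is \<open>pmf \<mu> k\<close>; its variance is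
  \<open>?t * (1 - ?t)\<close>, where \<open>1 - ?t\<close> is at least the mass of 0, uniformly in
  \<open>k\<close>.\<close>

lemma poincare_tail:
  assumes full: "set_pmf \<mu> = UNIV" and C: "0 < C" and P: "poincare \<mu> C"
  obtains K where "0 < K" "\<And>k. tail \<mu> (Suc k) \<le> K * pmf \<mu> k"
proof
  have \<mu>0: "0 < pmf \<mu> 0" using full by (simp add: pmf_positive)
  then show "0 < C / (2 * pmf \<mu> 0)" using C by simp
  fix k
  define f :: "nat \<Rightarrow> real" where "f = indicator {Suc k..}"
  let ?t = "tail \<mu> (Suc k)"
  have "f \<in> dirichlet_dom \<mu>"
    by (rule bounded_in_dirichlet_dom[of _ 1]) (simp add: f_def indicator_def)
  then have "measure_pmf.variance \<mu> f \<le> C / 2 * dirichlet_form \<mu> f f"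
    using P by (simp add: poincare_def)
  moreover have "measure_pmf.variance \<mu> f = ?t - ?t\<^sup>2"
  proof -
    have sq: "(\<lambda>k. (f k)\<^sup>2) = f" by (auto simp: f_def indicator_def)
    have "integrable (measure_pmf \<mu>) f" unfolding f_def
      by (intro measure_pmf.integrable_const_bound[of _ 1]) (auto simp: indicator_def)
    then show ?thesis using measure_pmf.variance_eq[of \<mu> f]
      unfolding sq by (simp add: f_def tail_def)
  qed
  moreover have "dirichlet_form \<mu> f f = pmf \<mu> k"
  proof -
    have "(\<lambda>j. fwd_diff f j * fwd_diff f j * pmf \<mu> j) = (\<lambda>j. if j = k then pmf \<mu> k else 0)"
      by (auto simp: fwd_diff_def f_def indicator_def)
    moreover have "(\<Sum>j. if j = k then pmf \<mu> k else 0) = pmf \<mu> k"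
      using sums_single[of k "\<lambda>_. pmf \<mu> k"] by (rule sums_unique[symmetric])
    ultimately show ?thesis by (simp only: dirichlet_form_def)
  qed
  ultimately have le: "?t - ?t\<^sup>2 \<le> C / 2 * pmf \<mu> k" by simp
  have "?t \<le> tail \<mu> 1" by (rule tail_antimono) simp
  then have "pmf \<mu> 0 \<le> 1 - ?t" using tail_Suc[of \<mu> 0] by (simp add: tail_0)
  then have "?t * pmf \<mu> 0 \<le> ?t * (1 - ?t)" by (intro mult_left_mono) (simp_all add: tail_def)
  then show "?t \<le> C / (2 * pmf \<mu> 0) * pmf \<mu> k"
    using le \<mu>0 by (simp add: power2_eq_square field_simps)
qed

section \<open>The entropy density \<open>x * ln x - x + 1\<close> and its one-edge
  contraction\<close>

lemma x_log_x_nonneg: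
  assumes "0 < x"
  shows "0 \<le> x * ln x - x + (1::real)"
proof -
  have "x * (1 - 1 / x) \<le> x * ln x"
    using ln_le_minus_one[of "1 / x"] assms by (intro mult_left_mono) (auto simp: ln_div)
  then show ?thesis using assms by (simp add: right_diff_distrib)
qed

text \<open>Bounding \<open>ln x = 2 * ln s\<close> by \<open>2 * (s - 1)\<close>, with
  \<open>s = sqrt x\<close>, leaves a cubic in \<open>s\<close> with a double root at 1.\<close>

lemma x_log_x_le_sqrt:
  assumes "0 < x"
  shows "x * ln x - x + (1::real) \<le> (2 * sqrt x + 1) * (sqrt x - 1)\<^sup>2"
proof -
  define s where "s = sqrt x"
  have s: "0 < s" "x = s\<^sup>2" using assms by (simp_all add: s_def)
  have "ln x \<le> 2 * (s - 1)" using ln_le_minus_one[OF s(1)] s by (simp add: ln_realpow)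
  then have "x * ln x \<le> x * (2 * (s - 1))" using assms by (intro mult_left_mono) auto
  then have "x * ln x - x + 1 \<le> s\<^sup>2 * (2 * (s - 1)) - s\<^sup>2 + 1" using s by simp
  also have "\<dots> = (2 * s + 1) * (s - 1)\<^sup>2" by (simp add: power2_eq_square algebra_simps)
  finally show ?thesis by (simp add: s_def)
qed

text \<open>In this one-edge estimate \<open>u, v\<close> are consecutive values of the function, \<open>t, t'\<close> the tails
  and \<open>m, m'\<close> the masses at the two sites. If \<open>v / u\<close> is at least the tail ratio divided by \<open>r\<close>,
  the new entropy is paid for by the energy of the edge, because \<open>v \<le> 1 / m'\<close> makes \<open>ln v\<close>
  comparable to \<open>ln (2 / t')\<close>; otherwise \<open>v t'\<close> is at most \<open>u t / r\<close>.\<close>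

lemma entropy_step:
  fixes u v t t' m m' K0 K2 CH r p :: real
  assumes p: "0 < p" "p \<le> 1"
    and uv: "0 < u" "0 < v" and t: "0 < t'" "t' \<le> t" "t' \<le> 1" and m: "0 < m" "0 < m'"
    and K0: "1 \<le> K0" "t \<le> K0 * m" "t' \<le> K0 * m'"
    and vm: "v * m' \<le> 1"
    and CH: "0 < CH" "ln (2 / t') \<le> CH * H p (t / t')"
    and r: "1 < r" "r\<^sup>2 \<le> t / t'"
    and K2: "0 < K2" "\<And>R x. r\<^sup>2 \<le> R \<Longrightarrow> R / r \<le> x \<Longrightarrow> H p R / R \<le> K2 * (H p x / x)"
  shows "(v * ln v - v + 1) * t' \<le> (u * ln u - u + 1) * t / r
    + ((1 + K0 / ln 2) * CH * K2 * K0 + 6 * K0 / p) * (u * H p (v / u) * m)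
    + 16 * K0 * ((sqrt u - 1)\<^sup>2 * m) + 9 * K0 * ((sqrt v - 1)\<^sup>2 * m')"
    (is "?L \<le> ?U + (?A + ?B) * ?E + ?X + ?Y")
proof -
  have t0: "0 < t" using t by simp
  define x where "x = v / u"
  have x: "0 < x" "v = x * u" using uv by (simp_all add: x_def)
  have U0: "0 \<le> ?U" using x_log_x_nonneg[OF uv(1)] t0 r by simp
  have Hx: "0 \<le> H p x" using H_nonneg[OF p x(1)] .
  have E: "?E = u * H p x * m" by (simp add: x_def)
  have E0: "0 \<le> ?E" unfolding E using Hx uv m by simp
  have A0: "0 \<le> ?A" using CH K2 K0 by simp
  have B0: "0 \<le> ?B" using p K0 by simp
  have AE: "0 \<le> ?A * ?E" "0 \<le> ?B * ?E" using A0 B0 E0 by (simp_all only: mult_nonneg_nonneg)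
  have X0: "0 \<le> ?X" and Y0: "0 \<le> ?Y" using K0 m by simp_all
  have uHt: "u * H p x * t \<le> K0 * ?E" unfolding E
    using mult_left_mono[OF K0(2), of "u * H p x"] uv Hx by (simp add: mult_ac)
  show ?thesis
  proof (cases "v \<le> 16")
    case True
    \<comment> \<open>The threshold 16 yields the factor \<open>2 * 4 + 1 = 9\<close>; beyond it,
      \<open>v < 2 * u\<close> will force \<open>4 \<le> u\<close>.\<close>
    then have "sqrt v \<le> sqrt 16" by (rule real_sqrt_le_mono)
    then have "2 * sqrt v + 1 \<le> 9" by simp
    then have "(2 * sqrt v + 1) * (sqrt v - 1)\<^sup>2 \<le> 9 * (sqrt v - 1)\<^sup>2"
      by (rule mult_right_mono) simp
    then have "v * ln v - v + 1 \<le> 9 * (sqrt v - 1)\<^sup>2" using x_log_x_le_sqrt[OF uv(2)] by linarith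
    then have "?L \<le> 9 * (sqrt v - 1)\<^sup>2 * (K0 * m')"
      using t K0 by (intro mult_mono) auto
    then have "?L \<le> ?Y" by (simp add: mult_ac)
    then show ?thesis using U0 AE X0 unfolding distrib_right by linarith
  next
    case v16: False
    have L: "?L \<le> v * ln v * t'" using v16 t by (intro mult_right_mono) auto
    show ?thesis
    proof (cases "(t / t') / r \<le> x")
      case True
      have ln2: "0 < ln (2::real)" by simp
      \<comment> \<open>The additive error \<open>K0\<close> is absorbed into a multiple of
        \<open>ln (2 / t')\<close>, which is at least \<open>ln 2\<close> because
        \<open>t' \<le> 1\<close>.\<close>
      have "ln v \<le> ln (1 / m')" using vm uv m by (simp add: field_simps)
      also have "\<dots> \<le> ln (K0 / t')" using K0 m t by (simp add: field_simps)
      also have "\<dots> = ln (2 / t') + ln K0 - ln 2" using K0 t by (simp add: ln_div)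
      also have "\<dots> \<le> ln (2 / t') + K0" using ln_le_minus_one[of K0] K0 ln2 by linarith
      also have "\<dots> \<le> (1 + K0 / ln 2) * ln (2 / t')"
      proof -
        have "ln 2 \<le> ln (2 / t')" using t by (simp add: field_simps)
        then have "K0 / ln 2 * ln 2 \<le> K0 / ln 2 * ln (2 / t')" using K0 by (intro mult_left_mono) auto
        then show ?thesis by (simp add: distrib_right)
      qed
      also have "\<dots> \<le> (1 + K0 / ln 2) * (CH * H p (t / t'))"
        using CH K0 by (intro mult_left_mono) auto
      finally have "v * t' * ln v \<le> v * t' * ((1 + K0 / ln 2) * (CH * H p (t / t')))"
        using uv t by (intro mult_left_mono) auto
      \<comment> \<open>Dividing \<open>H p\<close> by its argument \<open>t / t'\<close> turns
        \<open>t'\<close> into \<open>t\<close> and prepares the comparison with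
        \<open>H p x / x\<close>.\<close>
      also have "\<dots> = (1 + K0 / ln 2) * CH * (v * t) * (H p (t / t') / (t / t'))"
        using t0 t by simp
      also have "\<dots> \<le> (1 + K0 / ln 2) * CH * (v * t) * (K2 * (H p x / x))"
        using K2(2)[OF r(2) True] K0 CH uv t0 by (intro mult_left_mono) auto
      also have "\<dots> = (1 + K0 / ln 2) * CH * K2 * (u * H p x * t)"
        using x by simp
      also have "\<dots> \<le> (1 + K0 / ln 2) * CH * K2 * (K0 * ?E)"
        using uHt K0 CH K2 by (intro mult_left_mono) auto
      finally have "v * ln v * t' \<le> ?A * ?E" by (simp add: mult_ac)
      then show ?thesis using L U0 AE X0 Y0 unfolding distrib_right by linarith
    next
      case False
      then have xr: "x * t' / t \<le> 1 / r" using t t0 r by (simp add: field_simps)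
      \<comment> \<open>Here \<open>ln v = ln u + ln x\<close> is expanded and
        \<open>u * ln u\<close> is rewritten as the entropy density at \<open>u\<close> plus
        \<open>u - 1\<close>; the density carries the contraction factor
        \<open>x * t' / t \<le> 1 / r\<close>.\<close>
      have "v * ln v * t' = x * t' / t * ((u * ln u - u + 1) * t) + x * t' * (u - 1) + x * t' * u * ln x"
        using x uv t0 by (simp add: ln_mult field_simps)
      also have "\<dots> \<le> 1 / r * ((u * ln u - u + 1) * t) + x * t' * u + x * t' * u * ln x"
      proof -
        have "x * t' / t * ((u * ln u - u + 1) * t) \<le> 1 / r * ((u * ln u - u + 1) * t)"
          using xr x_log_x_nonneg[OF uv(1)] t0 by (intro mult_right_mono mult_nonneg_nonneg) auto
        moreover have "x * t' * (u - 1) \<le> x * t' * u" using x t by (intro mult_left_mono) auto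
        ultimately show ?thesis by linarith
      qed
      also have "\<dots> = ?U + t' * u * (x * (1 + ln x))"
      proof -
        have "1 / r * (y * t) = y * t / r" for y by simp
        moreover have "x * t' * u + x * t' * u * ln x = t' * u * (x * (1 + ln x))"
          by (simp add: algebra_simps)
        ultimately show ?thesis by (simp only: add.assoc)
      qed
      finally have L2: "?L \<le> ?U + t' * u * (x * (1 + ln x))" using L by linarith
      show ?thesis
      proof (cases "2 \<le> x")
        case True
        \<comment> \<open>From \<open>1 \<le> 2 * ln x\<close> the error is at most
          \<open>3 * x * ln x\<close>, and \<open>H_ge_x_log\<close> contributes the factor
          \<open>2 / p\<close>.\<close>
        have "1 / 2 \<le> ln (2::real)" using ln_le_minus_one[of "1 / 2 :: real"] by (simp add: ln_div)
        also have "\<dots> \<le> ln x" using True by simp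
        finally have "x * (1 + ln x) \<le> x * (3 * ln x)" using x by (intro mult_left_mono) auto
        also have "\<dots> \<le> 6 / p * H p x" using H_ge_x_log[OF p True] p by (simp add: field_simps)
        finally have "t' * u * (x * (1 + ln x)) \<le> t * u * (6 / p * H p x)"
        proof -
          assume "x * (1 + ln x) \<le> 6 / p * H p x"
          then have "t' * u * (x * (1 + ln x)) \<le> t' * u * (6 / p * H p x)"
            using t uv by (intro mult_left_mono) auto
          also have "\<dots> \<le> t * u * (6 / p * H p x)"
            using t uv p Hx by (intro mult_right_mono mult_nonneg_nonneg) auto
          finally show ?thesis .
        qed
        also have "\<dots> = 6 / p * (u * H p x * t)" by (simp add: mult_ac)
        also have "\<dots> \<le> 6 / p * (K0 * ?E)" using uHt p by (intro mult_left_mono) auto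
        finally have "t' * u * (x * (1 + ln x)) \<le> ?B * ?E" by simp
        then show ?thesis using L2 AE X0 Y0 unfolding distrib_right by linarith
      next
        case False
        have "x * (1 + ln x) \<le> x * 2" using ln_le_minus_one[OF x(1)] False x by (intro mult_left_mono) auto
        then have "x * (1 + ln x) \<le> 4" using False by linarith
        then have "t' * u * (x * (1 + ln x)) \<le> t' * u * 4" using t uv by (intro mult_left_mono) auto
        also have "\<dots> \<le> 4 * u * (K0 * m)" using t K0 uv by (simp add: mult_ac mult_left_mono)
        also have "\<dots> \<le> 4 * (4 * (sqrt u - 1)\<^sup>2) * (K0 * m)"
        proof -
          \<comment> \<open>Since \<open>u\<close> stays away from 1, the error of order
            \<open>u\<close> is bounded by a multiple of the squared distance of
            \<open>sqrt u\<close> from 1.\<close>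
          have "16 < x * u" using v16 x by simp
          also have "\<dots> \<le> 2 * u" using False uv by (intro mult_right_mono) auto
          finally have "4 \<le> u" by simp
          then have s: "2 \<le> sqrt u" by (simp add: real_le_rsqrt)
          have "z * z \<le> 4 * (z - 1)\<^sup>2" if "2 \<le> z" for z :: real
          proof -
            have "0 \<le> (z - 2) * (3 * z - 2)" using that by (intro mult_nonneg_nonneg) auto
            then show ?thesis by (simp add: power2_eq_square algebra_simps)
          qed
          from this[OF s] have "u \<le> 4 * (sqrt u - 1)\<^sup>2" using uv by simp
          then show ?thesis using K0 m by (intro mult_right_mono mult_left_mono) auto
        qed
        finally have "t' * u * (x * (1 + ln x)) \<le> ?X" by (simp add: mult_ac)
        then show ?thesis using L2 AE Y0 unfolding distrib_right by linarith
      qed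
    qed
  qed
qed

section \<open>From the one-edge estimate to the entropy inequality\<close>

lemma expectation_pos:
  fixes g :: "nat \<Rightarrow> real"
  assumes full: "set_pmf \<mu> = UNIV" and g: "\<And>k. 0 < g k" "integrable (measure_pmf \<mu>) g"
  shows "g k * pmf \<mu> k \<le> measure_pmf.expectation \<mu> g" "0 < measure_pmf.expectation \<mu> g"
proof -
  have "g k * pmf \<mu> k \<le> measure_pmf.expectation \<mu> g" for k
    using sum_le_suminf[OF sums_summable[OF pmf_nat_expectation_sums[OF g(2)]], of "{k}"] g(1)
      sums_unique[OF pmf_nat_expectation_sums[OF g(2)]]
    by (simp add: less_imp_le)
  from this this[of 0] show "g k * pmf \<mu> k \<le> measure_pmf.expectation \<mu> g"
    "0 < measure_pmf.expectation \<mu> g"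
    using g(1)[of 0] pmf_positive[of 0 \<mu>] full
    by (auto intro: less_le_trans[OF mult_pos_pos])
qed

text \<open>For \<open>s = sqrt g\<close> of second moment 1 and mean \<open>e\<close>, the
  expectation of the squared deviation from 1 is \<open>2 - 2 * e\<close>. Since
  \<open>0 \<le> e \<le> 1\<close>, this is at most twice the variance \<open>1 - e * e\<close>,
  which Poincare and \<open>H_ge_sqrt\<close> control.\<close>

lemma sqrt_variance_le_energy:
  assumes p: "0 < p" "p \<le> 1" and C: "0 < C" and P: "poincare \<mu> C"
    and g: "\<And>k. 0 < g k" and int: "integrable (measure_pmf \<mu>) g"
    and E1: "measure_pmf.expectation \<mu> g = 1" and S: "summable (edge_energy p \<mu> g)"
  shows "integrable (measure_pmf \<mu>) (\<lambda>k. (sqrt (g k) - 1)\<^sup>2)"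
    and "measure_pmf.expectation \<mu> (\<lambda>k. (sqrt (g k) - 1)\<^sup>2) \<le> C / p * (\<Sum>k. edge_energy p \<mu> g k)"
proof -
  define s where "s k = sqrt (g k)" for k
  have s0: "0 < s k" and s2: "(s k)\<^sup>2 = g k" for k
    using g[of k] by (simp_all add: s_def)
  have le: "(fwd_diff s k)\<^sup>2 * pmf \<mu> k \<le> 1 / p * edge_energy p \<mu> g k" for k
  proof -
    have "p * (sqrt (g (Suc k) / g k) - 1)\<^sup>2 \<le> H p (g (Suc k) / g k)"
      using g by (intro H_ge_sqrt p) simp
    then have "g k * (p * (s (Suc k) / s k - 1)\<^sup>2) * pmf \<mu> k \<le> edge_energy p \<mu> g k"
      unfolding edge_energy_def s_def
      using g[of k] by (intro mult_right_mono mult_left_mono) (auto simp: real_sqrt_divide)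
    also have "g k * (p * (s (Suc k) / s k - 1)\<^sup>2) = p * (s k * (s (Suc k) / s k - 1))\<^sup>2"
      unfolding s2[symmetric] by (simp add: power_mult_distrib)
    also have "s k * (s (Suc k) / s k - 1) = fwd_diff s k"
      using s0[of k] by (simp add: fwd_diff_def field_simps)
    finally show ?thesis using p by (simp add: field_simps)
  qed
  have sumD: "summable (\<lambda>k. (fwd_diff s k)\<^sup>2 * pmf \<mu> k)"
    by (rule summable_comparison_test'[OF summable_mult[OF S, of "1 / p"], of 0])
       (use le in \<open>simp\<close>)
  have ints: "integrable (measure_pmf \<mu>) s"
  proof (rule Bochner_Integration.integrable_bound)
    show "integrable (measure_pmf \<mu>) (\<lambda>k. 1 + g k)" using int by simp
    have "s k \<le> 1 + g k" for k
      using sum_squares_bound[of "s k" 1] s2[of k] s0[of k] by simp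
    then show "AE k in measure_pmf \<mu>. norm (s k) \<le> norm (1 + g k)"
      using s0 g by (auto intro!: AE_I2 simp: less_imp_le)
  qed simp
  have int2: "integrable (measure_pmf \<mu>) (\<lambda>k. (s k)\<^sup>2)" unfolding s2 by (rule int)
  have "s \<in> dirichlet_dom \<mu>" using int2 sumD by (simp add: dirichlet_dom_def)
  then have "measure_pmf.variance \<mu> s \<le> C / 2 * dirichlet_form \<mu> s s"
    using P by (simp add: poincare_def)
  also have "dirichlet_form \<mu> s s \<le> (\<Sum>k. 1 / p * edge_energy p \<mu> g k)"
    unfolding dirichlet_form_def
    using le sumD S by (intro suminf_le summable_mult) (auto simp: power2_eq_square)
  also have "\<dots> = 1 / p * (\<Sum>k. edge_energy p \<mu> g k)" by (rule suminf_mult[OF S])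
  finally have "measure_pmf.variance \<mu> s \<le> C / 2 * (1 / p * (\<Sum>k. edge_energy p \<mu> g k))"
    using C by simp
  moreover have "measure_pmf.variance \<mu> s = 1 - (measure_pmf.expectation \<mu> s)\<^sup>2"
    using measure_pmf.variance_eq[OF ints int2] by (simp add: s2 E1)
  ultimately have v: "1 - (measure_pmf.expectation \<mu> s)\<^sup>2 \<le> C / (2 * p) * (\<Sum>k. edge_energy p \<mu> g k)"
    by simp
  have eq: "(\<lambda>k. (sqrt (g k) - 1)\<^sup>2) = (\<lambda>k. g k - 2 * s k + 1)"
  proof
    fix k
    have "(s k - 1)\<^sup>2 = (s k)\<^sup>2 - 2 * s k + 1" by (simp add: power2_eq_square algebra_simps)
    then show "(sqrt (g k) - 1)\<^sup>2 = g k - 2 * s k + 1" unfolding s2 by (simp add: s_def)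
  qed
  show "integrable (measure_pmf \<mu>) (\<lambda>k. (sqrt (g k) - 1)\<^sup>2)"
    unfolding eq using int ints by simp
  have "0 \<le> measure_pmf.variance \<mu> s" by (rule measure_pmf.variance_positive)
  then have "(measure_pmf.expectation \<mu> s)\<^sup>2 \<le> 1\<^sup>2"
    using measure_pmf.variance_eq[OF ints int2] by (simp add: s2 E1)
  then have es1: "measure_pmf.expectation \<mu> s \<le> 1" by (rule power2_le_imp_le) simp
  have es0: "0 \<le> measure_pmf.expectation \<mu> s"
    using s0 by (intro Bochner_Integration.integral_nonneg) (auto intro: less_imp_le)
  have "(measure_pmf.expectation \<mu> s)\<^sup>2 \<le> measure_pmf.expectation \<mu> s"
    using es0 es1 by (simp add: power2_eq_square mult_left_le)
  moreover have "measure_pmf.expectation \<mu> (\<lambda>k. (sqrt (g k) - 1)\<^sup>2) = 2 - 2 * measure_pmf.expectation \<mu> s"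
    unfolding eq using int ints by (simp add: E1)
  ultimately have "measure_pmf.expectation \<mu> (\<lambda>k. (sqrt (g k) - 1)\<^sup>2) \<le> 2 * (C / (2 * p) * (\<Sum>k. edge_energy p \<mu> g k))"
    using v by linarith
  then show "measure_pmf.expectation \<mu> (\<lambda>k. (sqrt (g k) - 1)\<^sup>2) \<le> C / p * (\<Sum>k. edge_energy p \<mu> g k)"
    by simp
qed

lemma entropy_le_energy_normalized:
  assumes p: "0 < p" "p \<le> 1" and full: "set_pmf \<mu> = UNIV"
    and C: "0 < C" and P: "poincare \<mu> C"
    and CH: "\<And>n. ln (2 / tail \<mu> (Suc n)) \<le> CH * H p (tail \<mu> n / tail \<mu> (Suc n))"
  obtains K where "0 < K"
    "\<And>g. \<lbrakk>\<And>k. 0 < g k; integrable (measure_pmf \<mu>) g;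
      integrable (measure_pmf \<mu>) (\<lambda>k. g k * ln (g k));
      measure_pmf.expectation \<mu> g = 1; summable (edge_energy p \<mu> g)\<rbrakk> \<Longrightarrow>
      Ent \<mu> g \<le> K * (\<Sum>k. edge_energy p \<mu> g k)"
proof -
  have \<mu>: "0 < pmf \<mu> k" for k using full by (simp add: pmf_positive)
  have tpos: "0 < tail \<mu> k" for k using \<mu>[of k] pmf_le_tail[of \<mu> k] by linarith
  obtain K1 where K1: "0 < K1" "\<And>k. tail \<mu> (Suc k) \<le> K1 * pmf \<mu> k"
    using poincare_tail[OF full C P] by blast
  define K0 where "K0 = 1 + K1"
  have K0: "1 \<le> K0" "tail \<mu> k \<le> K0 * pmf \<mu> k" for k
    using K1 tail_Suc[of \<mu> k] by (simp_all add: K0_def distrib_right)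
  \<comment> \<open>Only the square root of the guaranteed tail ratio \<open>1 + 1 / K1\<close> is
    spent on contraction, so the ratio divided by \<open>r\<close> still exceeds 1.\<close>
  define r where "r = sqrt (1 + 1 / K1)"
  have r: "1 < r" "r\<^sup>2 = 1 + 1 / K1" using K1 by (simp_all add: r_def add_nonneg_nonneg)
  have rR: "r\<^sup>2 \<le> tail \<mu> k / tail \<mu> (Suc k)" for k
  proof -
    have "tail \<mu> (Suc k) / K1 \<le> pmf \<mu> k" using K1 by (simp add: field_simps)
    then have "(1 + 1 / K1) * tail \<mu> (Suc k) \<le> tail \<mu> k"
      using tail_Suc[of \<mu> k] by (simp add: distrib_right)
    then show ?thesis unfolding r using tpos[of "Suc k"] by (simp add: le_divide_eq)
  qed
  have CH0: "0 < CH"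
  proof -
    have "1 < r\<^sup>2" using r(1) by simp
    then have "0 < H p (tail \<mu> 0 / tail \<mu> 1)" using rR[of 0] by (intro H_pos p) simp
    moreover have "0 < ln (2 / tail \<mu> 1)" using tpos[of 1] tail_le_1[of \<mu> 1] by simp
    moreover have "ln (2 / tail \<mu> 1) \<le> CH * H p (tail \<mu> 0 / tail \<mu> 1)" using CH[of 0] by simp
    ultimately show ?thesis by (metis less_le_trans zero_less_mult_pos2)
  qed
  obtain K2 where K2: "0 < K2"
    "\<And>R x. r\<^sup>2 \<le> R \<Longrightarrow> R / r \<le> x \<Longrightarrow> H p R / R \<le> K2 * (H p x / x)"
    using H_ratio_compare[OF p r(1)] by blast
  define A where "A = (1 + K0 / ln 2) * CH * K2 * K0 + 6 * K0 / p"
  \<comment> \<open>The first site has no preceding edge; there mean 1 gives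
    \<open>g 0 \<le> 1 / pmf \<mu> 0\<close>, so \<open>x_log_x_le_sqrt\<close> applies with a
    bounded factor.\<close>
  define B where "B = (2 / sqrt (pmf \<mu> 0) + 1) / pmf \<mu> 0"
  \<comment> \<open>Solves \<open>S \<le> S / r + A * \<E> + (B + 25 * K0) * V\<close> for
    \<open>S\<close>, with \<open>V \<le> C / p * \<E>\<close>; 25 is the sum of the constants 16
    and 9 of \<open>entropy_step\<close>.\<close>
  define K where "K = (A + (B + 25 * K0) * (C / p)) / (1 - 1 / r)"
  have A: "0 < A" unfolding A_def using K0(1) CH0 K2(1) p
    by (intro add_nonneg_pos mult_nonneg_nonneg) auto
  have B: "0 < B" unfolding B_def using \<mu>[of 0] by (intro divide_pos_pos add_pos_pos) auto
  have "0 < K" unfolding K_def using A B K0(1) C p r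
    by (intro divide_pos_pos add_pos_nonneg mult_nonneg_nonneg) auto
  moreover have "Ent \<mu> g \<le> K * (\<Sum>k. edge_energy p \<mu> g k)"
    if g: "\<And>k. 0 < g k" and int: "integrable (measure_pmf \<mu>) g"
      and intl: "integrable (measure_pmf \<mu>) (\<lambda>k. g k * ln (g k))"
      and E1: "measure_pmf.expectation \<mu> g = 1" and S: "summable (edge_energy p \<mu> g)" for g
  proof -
    define \<phi> where "\<phi> k = g k * ln (g k) - g k + 1" for k
    define s where "s k = (sqrt (g k) - 1)\<^sup>2" for k
    define \<E> where "\<E> = (\<Sum>k. edge_energy p \<mu> g k)"
    define V where "V = measure_pmf.expectation \<mu> s"
    note sv = sqrt_variance_le_energy[OF p C P g int E1 S]
    have ints: "integrable (measure_pmf \<mu>) s" using sv(1) by (simp add: s_def[abs_def])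
    have V: "V \<le> C / p * \<E>" using sv(2) by (simp add: V_def \<E>_def s_def[abs_def])
    have V_sums: "(\<lambda>k. s k * pmf \<mu> k) sums V" unfolding V_def by (rule pmf_nat_expectation_sums[OF ints])
    have s0: "0 \<le> s k * pmf \<mu> k" for k by (simp add: s_def)
    have V_part: "sum (\<lambda>k. s k * pmf \<mu> k) I \<le> V" if "finite I" for I
      using sum_le_suminf[OF sums_summable[OF V_sums] that] s0 sums_unique[OF V_sums] by simp
    have e0: "0 \<le> edge_energy p \<mu> g k" for k by (rule edge_energy_nonneg[OF p g])
    have \<E>_part: "sum (edge_energy p \<mu> g) I \<le> \<E>" if "finite I" for I
      unfolding \<E>_def using sum_le_suminf[OF S that] e0 by simp
    have \<phi>0: "0 \<le> \<phi> k" for k unfolding \<phi>_def by (rule x_log_x_nonneg[OF g])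
    have gm: "g k * pmf \<mu> k \<le> 1" for k using expectation_pos(1)[OF full g int] E1 by simp
    have step: "\<phi> (Suc k) * tail \<mu> (Suc k) \<le> \<phi> k * tail \<mu> k / r + A * edge_energy p \<mu> g k
        + 16 * K0 * (s k * pmf \<mu> k) + 9 * K0 * (s (Suc k) * pmf \<mu> (Suc k))" for k
      unfolding \<phi>_def s_def edge_energy_def A_def
      by (rule entropy_step[OF p g g tpos tail_antimono tail_le_1 \<mu> \<mu> K0(1,2,2) gm CH0 CH r(1) rR K2]) auto
    have first: "\<phi> 0 * tail \<mu> 0 \<le> B * V"
    proof -
      have "g 0 \<le> 1 / pmf \<mu> 0" using gm[of 0] \<mu>[of 0] by (simp add: field_simps)
      then have "sqrt (g 0) \<le> sqrt (1 / pmf \<mu> 0)" by (rule real_sqrt_le_mono)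
      then have "2 * sqrt (g 0) + 1 \<le> 2 / sqrt (pmf \<mu> 0) + 1" by (simp add: real_sqrt_divide)
      then have "(2 * sqrt (g 0) + 1) * s 0 \<le> (2 / sqrt (pmf \<mu> 0) + 1) * s 0"
        by (rule mult_right_mono) (simp add: s_def)
      then have "\<phi> 0 \<le> (2 / sqrt (pmf \<mu> 0) + 1) * s 0"
        using x_log_x_le_sqrt[OF g, of 0] by (simp add: \<phi>_def s_def)
      also have "\<dots> = B * (s 0 * pmf \<mu> 0)" using \<mu>[of 0] by (simp add: B_def)
      also have "\<dots> \<le> B * V" using V_part[of "{0}"] B by (intro mult_left_mono) auto
      finally show ?thesis by (simp add: tail_0)
    qed
    have part: "(\<Sum>k<N. \<phi> k * tail \<mu> k) \<le> K * \<E>" for N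
    proof -
      let ?S = "\<Sum>k<Suc N. \<phi> k * tail \<mu> k"
      have "?S = \<phi> 0 * tail \<mu> 0 + (\<Sum>k<N. \<phi> (Suc k) * tail \<mu> (Suc k))"
        by (rule sum.lessThan_Suc_shift)
      also have "\<dots> \<le> B * V + (\<Sum>k<N. \<phi> k * tail \<mu> k / r + A * edge_energy p \<mu> g k
        + 16 * K0 * (s k * pmf \<mu> k) + 9 * K0 * (s (Suc k) * pmf \<mu> (Suc k)))"
        by (intro add_mono first sum_mono step)
      also have "\<dots> = B * V + ((\<Sum>k<N. \<phi> k * tail \<mu> k) / r + A * (\<Sum>k<N. edge_energy p \<mu> g k)
        + 16 * K0 * (\<Sum>k<N. s k * pmf \<mu> k) + 9 * K0 * (\<Sum>k<N. s (Suc k) * pmf \<mu> (Suc k)))"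
        by (simp only: sum.distrib sum_distrib_left sum_divide_distrib)
      also have "\<dots> \<le> B * V + (?S / r + A * \<E> + 16 * K0 * V + 9 * K0 * V)"
      proof -
        have "(\<Sum>k<N. s (Suc k) * pmf \<mu> (Suc k)) = (\<Sum>k\<in>Suc ` {..<N}. s k * pmf \<mu> k)"
          by (simp add: sum.reindex)
        also have "\<dots> \<le> V" by (rule V_part) simp
        finally have "(\<Sum>k<N. s (Suc k) * pmf \<mu> (Suc k)) \<le> V" .
        moreover have "(\<Sum>k<N. \<phi> k * tail \<mu> k) \<le> ?S"
          using \<phi>0[of N] tpos[of N] by simp
        ultimately show ?thesis
          using V_part[of "{..<N}"] \<E>_part[of "{..<N}"] A B K0(1) r(1)
          by (intro add_mono mult_left_mono divide_right_mono) auto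
      qed
      finally have "?S - ?S / r \<le> A * \<E> + (B + 25 * K0) * V" unfolding distrib_right by linarith
      then have "?S * (1 - 1 / r) \<le> A * \<E> + (B + 25 * K0) * V" unfolding right_diff_distrib by simp
      also have "\<dots> \<le> A * \<E> + (B + 25 * K0) * (C / p * \<E>)"
        using V B K0(1) by (intro add_left_mono mult_left_mono) auto
      finally have "?S * (1 - 1 / r) \<le> (A + (B + 25 * K0) * (C / p)) * \<E>" by (simp add: algebra_simps)
      then have "?S \<le> K * \<E>" using r by (simp add: K_def pos_le_divide_eq)
      moreover have "(\<Sum>k<N. \<phi> k * tail \<mu> k) \<le> ?S"
        using \<phi>0[of N] tpos[of N] by simp
      ultimately show ?thesis by linarith
    qed
    \<comment> \<open>Mean 1 cancels both the term \<open>ln 1\<close> in the entropy and the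
      correction \<open>1 - g\<close> in the density.\<close>
    have "Ent \<mu> g = measure_pmf.expectation \<mu> \<phi>"
      using int intl E1 by (simp add: Ent_def \<phi>_def[abs_def])
    moreover have "integrable (measure_pmf \<mu>) \<phi>" using int intl by (simp add: \<phi>_def[abs_def])
    then have "(\<lambda>k. \<phi> k * pmf \<mu> k) sums measure_pmf.expectation \<mu> \<phi>"
      by (rule pmf_nat_expectation_sums)
    moreover have "(\<Sum>k<N. \<phi> k * pmf \<mu> k) \<le> K * \<E>" for N
      using part[of N] sum_mono[of "{..<N}" "\<lambda>k. \<phi> k * pmf \<mu> k" "\<lambda>k. \<phi> k * tail \<mu> k"]
        mult_left_mono[OF pmf_le_tail \<phi>0] by force
    ultimately show ?thesis unfolding \<E>_def[symmetric]
      by (metis sums_unique sums_summable suminf_le_const)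
  qed
  ultimately show ?thesis using that by blast
qed

text \<open>Removes the normalization by homogeneity: entropy and edge energy are both of degree 1,
  as \<open>H p\<close> sees only ratios of values.\<close>

lemma entropy_le_energy:
  assumes p: "0 < p" "p \<le> 1" and full: "set_pmf \<mu> = UNIV"
    and K: "\<And>g. \<lbrakk>\<And>k. 0 < g k; integrable (measure_pmf \<mu>) g;
      integrable (measure_pmf \<mu>) (\<lambda>k. g k * ln (g k));
      measure_pmf.expectation \<mu> g = 1; summable (edge_energy p \<mu> g)\<rbrakk> \<Longrightarrow>
      Ent \<mu> g \<le> K * (\<Sum>k. edge_energy p \<mu> g k)"
    and g: "\<And>k. 0 < g k" and int: "integrable (measure_pmf \<mu>) g"
    and intl: "integrable (measure_pmf \<mu>) (\<lambda>k. g k * ln (g k))"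
    and S: "summable (edge_energy p \<mu> g)"
  shows "Ent \<mu> g \<le> K * (\<Sum>k. edge_energy p \<mu> g k)"
proof -
  define M where "M = measure_pmf.expectation \<mu> g"
  have M: "0 < M" unfolding M_def by (rule expectation_pos(2)[OF full g int])
  define h where "h k = g k / M" for k
  have h0: "0 < h k" for k using g M by (simp add: h_def)
  have hl: "h k * ln (h k) = (g k * ln (g k)) / M - g k * (ln M / M)" for k
    using g[of k] M by (simp add: h_def ln_div right_diff_distrib diff_divide_distrib)
  have inth: "integrable (measure_pmf \<mu>) h" using int by (simp add: h_def[abs_def])
  have inthl: "integrable (measure_pmf \<mu>) (\<lambda>k. h k * ln (h k))" unfolding hl using int intl by simp
  have Eh: "measure_pmf.expectation \<mu> h = 1" using M by (simp add: h_def[abs_def] M_def)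
  have e: "edge_energy p \<mu> h = (\<lambda>k. edge_energy p \<mu> g k / M)"
    using M by (auto simp: edge_energy_def h_def)
  have "Ent \<mu> h = Ent \<mu> g / M"
    using int intl M unfolding Ent_def Eh hl by (simp add: M_def[symmetric] diff_divide_distrib)
  moreover have "Ent \<mu> h \<le> K * (\<Sum>k. edge_energy p \<mu> h k)"
    using S by (intro K h0 inth inthl Eh) (simp add: e)
  moreover have "(\<Sum>k. edge_energy p \<mu> h k) = (\<Sum>k. edge_energy p \<mu> g k) / M"
    unfolding e using S by (rule suminf_divide)
  ultimately show ?thesis using M by (simp add: divide_le_cancel)
qed

lemma log_sobolev_holds:
  assumes p: "0 < p" "p \<le> 1" and full: "set_pmf \<mu> = UNIV"
    and C: "0 < C" and P: "poincare \<mu> C"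
    and CH: "\<And>n. ln (2 / tail \<mu> (Suc n)) \<le> CH * H p (tail \<mu> n / tail \<mu> (Suc n))"
  obtains C' where "0 < C'" "log_sobolev p \<mu> C'"
proof -
  obtain K where K: "0 < K"
    "\<And>g. \<lbrakk>\<And>k. 0 < g k; integrable (measure_pmf \<mu>) g;
      integrable (measure_pmf \<mu>) (\<lambda>k. g k * ln (g k));
      measure_pmf.expectation \<mu> g = 1; summable (edge_energy p \<mu> g)\<rbrakk> \<Longrightarrow>
      Ent \<mu> g \<le> K * (\<Sum>k. edge_energy p \<mu> g k)"
    using entropy_le_energy_normalized[OF p full C P CH] by blast
  have "Ent \<mu> (\<lambda>k. f k powr p) \<le> K * (\<Sum>k. edge_energy p \<mu> (\<lambda>k. f k powr p) k)"
    if f: "f \<in> dirichlet_dom_pos \<mu>" and S: "summable (edge_energy p \<mu> (\<lambda>k. f k powr p))" for f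
  proof -
    have f0: "0 < f k" for k using f by (simp add: dirichlet_dom_pos_def)
    have int2: "integrable (measure_pmf \<mu>) (\<lambda>k. 2 + (f k)\<^sup>2)"
      using f by (simp add: dirichlet_dom_pos_def dirichlet_dom_def)
    have powr_le: "x powr q \<le> 1 + x\<^sup>2" if "0 < x" "0 \<le> q" "q \<le> 2" for x q :: real
    proof (cases "1 \<le> x")
      case True
      then have "x powr q \<le> x powr 2" using that by (intro powr_mono) auto
      then show ?thesis using that by simp
    next
      case False
      then have "x powr q \<le> 1" using that by (simp add: powr_le1)
      then show ?thesis by (smt (verit) zero_le_power2)
    qed
    let ?g = "\<lambda>k. f k powr p"
    have g0: "0 < ?g k" for k using f0[of k] by simp
    have 1: "integrable (measure_pmf \<mu>) ?g"
    proof (rule Bochner_Integration.integrable_bound[OF int2])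
      have "?g k \<le> 2 + (f k)\<^sup>2" for k using powr_le[OF f0, of p k] p by simp
      then show "AE k in measure_pmf \<mu>. norm (?g k) \<le> norm (2 + (f k)\<^sup>2)"
        by (auto intro!: AE_I2)
    qed simp
    have 2: "integrable (measure_pmf \<mu>) (\<lambda>k. ?g k * ln (?g k))"
    proof (rule Bochner_Integration.integrable_bound[OF int2])
      \<comment> \<open>From above \<open>ln y \<le> y\<close> leaves
        \<open>f k powr (2 * p)\<close>, whose exponent is at most 2; from below
        \<open>y * ln y \<ge> y - 1\<close>. Square integrability of \<open>f\<close> thus
        suffices.\<close>
      have "\<bar>?g k * ln (?g k)\<bar> \<le> 2 + (f k)\<^sup>2" for k
      proof -
        have "?g k * ln (?g k) \<le> ?g k * ?g k"
          using ln_le_minus_one[OF g0, of k] g0[of k] by (intro mult_left_mono) auto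
        also have "\<dots> = f k powr (2 * p)" by (simp flip: powr_add)
        also have "\<dots> \<le> 1 + (f k)\<^sup>2" using powr_le[OF f0, of "2 * p" k] p by simp
        finally have "?g k * ln (?g k) \<le> 1 + (f k)\<^sup>2" .
        moreover have "- 1 \<le> ?g k * ln (?g k)" using x_log_x_nonneg[OF g0, of k] g0[of k] by linarith
        moreover have "0 \<le> (f k)\<^sup>2" by simp
        ultimately show ?thesis by linarith
      qed
      then show "AE k in measure_pmf \<mu>. norm (?g k * ln (?g k)) \<le> norm (2 + (f k)\<^sup>2)"
        by (auto intro!: AE_I2)
    qed simp
    show ?thesis by (rule entropy_le_energy[OF p full K(2) g0 1 2 S])
  qed
  moreover have "summable (edge_energy p \<mu> (\<lambda>k. f k powr p))"
    if "f \<in> dirichlet_dom_pos \<mu>" "if p = 1 then (\<lambda>k. ln (f k)) \<in> dirichlet_dom \<mu>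
       else (\<lambda>k. f k powr (p - 1)) \<in> dirichlet_dom_pos \<mu>" for f
    using edge_energy_summable[OF p that] .
  ultimately have "log_sobolev p \<mu> (4 * K)"
    unfolding log_sobolev_iff[OF p] by simp
  then show ?thesis using K(1) by (intro that[of "4 * K"]) auto
qed

theorem theorem2p3:
  fixes p :: real and \<mu> :: "nat pmf"
  assumes "0 < p" and "p \<le> 1"
    and "set_pmf \<mu> = UNIV"
  shows
    "((\<exists>C\<^sub>P>0. poincare \<mu> C\<^sub>P) \<and>
      (SUP n\<in>{1..}. ereal (inverse (H p (tail \<mu> (n - 1) / tail \<mu> n)) * ln (2 / tail \<mu> n))) < \<infinity>
        \<longrightarrow> (\<exists>C>0. log_sobolev p \<mu> C)) \<and>
     ((\<exists>\<tau> :: nat \<Rightarrow> nat. strict_mono \<tau> \<and>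
        filterlim (\<lambda>n. inverse (H p (tail \<mu> (\<tau> (n - 1)) / tail \<mu> (\<tau> n))) *
                       (tail \<mu> (\<tau> (n - 1)) / tail \<mu> (\<tau> n - 1)) *
                       ln (2 / tail \<mu> (\<tau> n))) at_top sequentially)
        \<longrightarrow> \<not> (\<exists>C>0. log_sobolev p \<mu> C))"
proof (intro conjI impI)
  assume "(\<exists>C\<^sub>P>0. poincare \<mu> C\<^sub>P) \<and>
      (SUP n\<in>{1..}. ereal (inverse (H p (tail \<mu> (n - 1) / tail \<mu> n)) * ln (2 / tail \<mu> n))) < \<infinity>"
  then obtain C where C: "0 < C" "poincare \<mu> C" and
    fin: "(SUP n\<in>{1..}. ereal (inverse (H p (tail \<mu> (n - 1) / tail \<mu> n)) * ln (2 / tail \<mu> n))) < \<infinity>"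
    by blast
  obtain B where "(SUP n\<in>{1..}. ereal (inverse (H p (tail \<mu> (n - 1) / tail \<mu> n)) * ln (2 / tail \<mu> n))) < ereal B"
    using fin less_PInf_Ex_of_nat by auto
  then have "ereal (inverse (H p (tail \<mu> (Suc n - 1) / tail \<mu> (Suc n))) * ln (2 / tail \<mu> (Suc n))) \<le> ereal B" for n
    by (intro order.trans[OF SUP_upper less_imp_le]) auto
  then have B: "inverse (H p (tail \<mu> n / tail \<mu> (Suc n))) * ln (2 / tail \<mu> (Suc n)) \<le> B" for n
    by (simp only: ereal_less_eq diff_Suc_1)
  \<comment> \<open>Full support makes the tails strictly decreasing, so the ratio exceeds 1 and
    \<open>H p\<close> is positive and can be multiplied across.\<close>
  have "ln (2 / tail \<mu> (Suc n)) \<le> B * H p (tail \<mu> n / tail \<mu> (Suc n))" for n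
  proof -
    have "0 < pmf \<mu> n" "0 < pmf \<mu> (Suc n)" using assms(3) by (simp_all add: pmf_positive)
    then have "0 < tail \<mu> (Suc n)" "tail \<mu> (Suc n) < tail \<mu> n"
      using pmf_le_tail[of \<mu> "Suc n"] tail_Suc[of \<mu> n] by linarith+
    then have "0 < H p (tail \<mu> n / tail \<mu> (Suc n))" by (intro H_pos assms) simp
    then show ?thesis using B[of n] by (simp add: field_simps)
  qed
  from log_sobolev_holds[OF assms C this] show "\<exists>C>0. log_sobolev p \<mu> C" by blast
next
  assume "\<exists>\<tau> :: nat \<Rightarrow> nat. strict_mono \<tau> \<and>
        filterlim (\<lambda>n. inverse (H p (tail \<mu> (\<tau> (n - 1)) / tail \<mu> (\<tau> n))) *
                       (tail \<mu> (\<tau> (n - 1)) / tail \<mu> (\<tau> n - 1)) *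
                       ln (2 / tail \<mu> (\<tau> n))) at_top sequentially"
  then show "\<not> (\<exists>C>0. log_sobolev p \<mu> C)"
    using log_sobolev_fails[OF assms(3) _ assms(1,2)] by blast
qed

end
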